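(* Let $H$ be a Hilbert space and let $A\subseteq\mathcal{B}(H)$ be a C$^*$-algebra of real rank zero such that $\mathcal{P}(A)$ is $\sigma$-closed. Then, for all $P,Q\in\mathcal{P}(A)$, $P\wedge Q\in A$ if and only if $P\vee Q\in A$.
   Context: Hilbert spaces and C$^*$-algebras are over $\mathbb{F}=\mathbb{R}$ or $\mathbb{C}$. $\mathcal{P}(A)$ is the set of projections (self-adjoint idempotents) of $A$, ordered by $P\leq Q\Leftrightarrow PQ=P$. $P\wedge Q$ and $P\vee Q$ denote the greatest lower bound and least upper bound in $\mathcal{P}(\mathcal{B}(H))$, i.e. the projections onto $\mathcal{R}(P)\cap\mathcal{R}(Q)$ and $\overline{\mathcal{R}(P)+\mathcal{R}(Q)}$ respectively ($\mathcal{R}$ denotes range). $A$ has real rank zero if the invertible self-adjoint elements are dense in the self-adjoint elements of $A$ (of $A$ with a unit adjoined, if $A$ has none). A partially ordered set with minimum $0$ is $\sigma$-closed if every decreasing sequence of non-zero elements has a non-zero lower bound in it. *)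

theory Defs
  imports "HOL-Analysis.Analysis"
begin

section \<open>The scalar field: the reals or the complex numbers\<close>

text \<open>
  The axioms force the field to be the reals or the complex numbers, with \<open>rc_cnj\<close> the
  usual conjugation; see \<open>rc_field_real_or_complex\<close> below.
\<close>

class rc_field = real_normed_field +
  fixes rc_cnj :: "'a \<Rightarrow> 'a"
  assumes rc_cnj_add: "rc_cnj (x + y) = rc_cnj x + rc_cnj y"
    and rc_cnj_mult: "rc_cnj (x * y) = rc_cnj x * rc_cnj y"
    and rc_cnj_cnj: "rc_cnj (rc_cnj x) = x"
    and mult_rc_cnj_scaleR: "x * rc_cnj x = (norm x)\<^sup>2 *\<^sub>R 1"

instantiation real :: rc_field
begin
definition rc_cnj_real :: "real \<Rightarrow> real" where "rc_cnj_real x = x"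
instance by standard (simp_all add: rc_cnj_real_def power2_eq_square)
end

instantiation complex :: rc_field
begin
definition rc_cnj_complex :: "complex \<Rightarrow> complex" where "rc_cnj_complex = cnj"
instance by standard
  (simp_all add: rc_cnj_complex_def scaleR_conv_of_real complex_norm_square del: of_real_power)
end

lemma mult_rc_cnj: "x * rc_cnj x = of_real ((norm x)\<^sup>2)" for x :: "'k::rc_field"
  unfolding of_real_def by (rule mult_rc_cnj_scaleR)

lemma rc_cnj_of_real: "rc_cnj (of_real r :: 'k::rc_field) = of_real r"
proof (cases "r = 0")
  case True
  have "rc_cnj (0 + 0 :: 'k) = rc_cnj 0 + rc_cnj 0" by (rule rc_cnj_add)
  then show ?thesis using True by simp
next
  case False
  have "of_real r * rc_cnj (of_real r) = (of_real r * of_real r :: 'k)"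
    using mult_rc_cnj[of "of_real r :: 'k"] by (simp add: power2_eq_square)
  then show ?thesis using False by simp
qed

lemma add_rc_cnj_Reals: "z + rc_cnj z \<in> \<real>" for z :: "'k::rc_field"
proof -
  have "(1 + z) * rc_cnj (1 + z) = 1 + (z + rc_cnj z) + z * rc_cnj z"
    using rc_cnj_of_real[of 1, where 'k = 'k] by (simp add: rc_cnj_add algebra_simps)
  then have "z + rc_cnj z = of_real ((norm (1 + z))\<^sup>2 - 1 - (norm z)\<^sup>2)"
    unfolding mult_rc_cnj by (simp add: algebra_simps)
  then show ?thesis by (metis Reals_of_real)
qed

lemma rc_field_square_nonpos:
  obtains a w where "z = of_real a + w" "w * w = - (of_real ((norm w)\<^sup>2) :: 'k::rc_field)"
    "rc_cnj w = - w"
proof -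
  obtain t where t: "z + rc_cnj z = of_real t"
    using add_rc_cnj_Reals[of z] by (auto elim: Reals_cases)
  define w where "w = z - of_real (t / 2)"
  have z: "z = w + of_real (t / 2)" by (simp add: w_def)
  have "rc_cnj z = rc_cnj w + of_real (t / 2)"
    unfolding z by (simp only: rc_cnj_add rc_cnj_of_real)
  then have "of_real t = w + rc_cnj w + (of_real (t / 2) + of_real (t / 2))"
    using t z by (simp only: ac_simps)
  also have "of_real (t / 2) + of_real (t / 2) = (of_real t :: 'k)"
    by (simp flip: of_real_add)
  finally have "w + rc_cnj w = 0" by simp
  then have c: "rc_cnj w = - w" by (rule minus_unique[symmetric])
  have "w * w = - (w * rc_cnj w)" unfolding c by simp
  then have "w * w = - of_real ((norm w)\<^sup>2)" unfolding mult_rc_cnj .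
  moreover have "z = of_real (t / 2) + w" by (simp add: w_def)
  ultimately show ?thesis using that c by blast
qed

lemma rc_field_real_or_complex:
  "(UNIV :: 'k::rc_field set) = \<real> \<or>
   (\<exists>i::'k. i * i = -1 \<and> (\<forall>z. \<exists>a b. z = of_real a + of_real b * i) \<and>
      (\<forall>a b. rc_cnj (of_real a + of_real b * i) = of_real a - of_real b * i))"
proof (cases "(UNIV :: 'k set) = \<real>")
  case False
  then obtain z :: 'k where z: "z \<notin> \<real>" by auto
  obtain a w where w: "z = of_real a + w" "w * w = - of_real ((norm w)\<^sup>2)" "rc_cnj w = - w"
    by (rule rc_field_square_nonpos)
  have w0: "w \<noteq> 0" using z w by auto
  define i where "i = of_real (1 / norm w) * w"
  have "i * i = of_real (1 / norm w) * of_real (1 / norm w) * (w * w)"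
    by (simp add: i_def algebra_simps)
  also have "\<dots> = - of_real (1 / norm w * (1 / norm w) * (norm w)\<^sup>2)"
    unfolding w(2) by (simp only: of_real_mult) simp
  finally have i: "i * i = -1" using w0 by (simp add: power2_eq_square)
  have ci: "rc_cnj i = - i"
    unfolding i_def by (simp only: rc_cnj_mult rc_cnj_of_real w(3)) simp
  have "\<exists>a b. y = of_real a + of_real b * i" for y
  proof -
    obtain c v where v: "y = of_real c + v" "v * v = - of_real ((norm v)\<^sup>2)"
      by (rule rc_field_square_nonpos)
    have "(of_real (norm v) * i) * (of_real (norm v) * i) = of_real ((norm v)\<^sup>2) * (i * i)"
      by (simp add: power2_eq_square ac_simps)
    then have "v * v = (of_real (norm v) * i) * (of_real (norm v) * i)"
      using v(2) i by simp
    then have "v = of_real (norm v) * i \<or> v = of_real (- norm v) * i"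
      by (simp add: square_eq_iff)
    then show ?thesis using v(1) by metis
  qed
  moreover have "rc_cnj (of_real a + of_real b * i) = of_real a - of_real b * i" for a b
    by (simp add: rc_cnj_add rc_cnj_mult rc_cnj_of_real ci)
  ultimately show ?thesis using i by blast
qed simp


section \<open>Hilbert spaces\<close>

text \<open>
  A Hilbert space over \<open>'k\<close> is a complete library space carrying a \<open>'k\<close>-valued inner
  product \<open>ip\<close> (linear in the first argument) that induces the library norm. By polarisation
  the library's real inner product is then the real part of \<open>ip\<close>, so the sort
  constraint \<open>real_inner\<close> costs no generality.
\<close>

locale hilbert_space = vector_space scl
  for scl :: "'k::rc_field \<Rightarrow> 'a::{real_inner,complete_space} \<Rightarrow> 'a" +
  fixes ip :: "'a \<Rightarrow> 'a \<Rightarrow> 'k"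
  assumes scl_of_real: "scl (of_real r) x = r *\<^sub>R x"
    and ip_add_left: "ip (x + y) z = ip x z + ip y z"
    and ip_scl_left: "ip (scl c x) y = c * ip x y"
    and ip_commute: "ip y x = rc_cnj (ip x y)"
    and ip_self: "ip x x = of_real ((norm x)\<^sup>2)"

lemma hilbert_space_real:
  "hilbert_space (scaleR :: real \<Rightarrow> 'a::{real_inner,complete_space} \<Rightarrow> 'a) inner"
  by unfold_locales
    (simp_all add: algebra_simps rc_cnj_real_def inner_commute power2_norm_eq_inner)

lemma hilbert_space_complex: "hilbert_space (*) (\<lambda>x y :: complex. x * cnj y)"
  by unfold_locales
    (simp_all add: algebra_simps rc_cnj_complex_def scaleR_conv_of_real complex_norm_square
      del: of_real_power)


section \<open>Operators\<close>

text \<open>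
  The library type of bounded operators consists of the real-linear ones;
  \<open>bounded_ops\<close> selects the \<open>'k\<close>-linear ones among them.
\<close>

definition bounded_ops ::
  "('k::rc_field \<Rightarrow> 'a::{real_inner,complete_space} \<Rightarrow> 'a) \<Rightarrow> ('a \<Rightarrow>\<^sub>L 'a) set" where
  "bounded_ops scl = {T. \<forall>c x. blinfun_apply T (scl c x) = scl c (blinfun_apply T x)}"

definition op_scale ::
  "('k::rc_field \<Rightarrow> 'a::{real_inner,complete_space} \<Rightarrow> 'a) \<Rightarrow> 'k \<Rightarrow> ('a \<Rightarrow>\<^sub>L 'a) \<Rightarrow> ('a \<Rightarrow>\<^sub>L 'a)" where
  "op_scale scl c T = Blinfun (\<lambda>x. scl c (blinfun_apply T x))"

lemma (in hilbert_space) norm_scl: "norm (scl c x) = norm c * norm x"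
proof -
  have "ip (scl c x) (scl c x) = c * rc_cnj c * ip x x"
  proof -
    have "ip x (scl c x) = rc_cnj c * ip x x"
      using ip_commute[of x "scl c x"] ip_commute[of x x]
      by (simp only: ip_scl_left rc_cnj_mult)
    then show ?thesis by (simp only: ip_scl_left mult.assoc)
  qed
  then have "of_real ((norm (scl c x))\<^sup>2) = (of_real ((norm c * norm x)\<^sup>2) :: 'k)"
    unfolding ip_self mult_rc_cnj by (simp add: power_mult_distrib)
  then have "(norm (scl c x))\<^sup>2 = (norm c * norm x)\<^sup>2" by (simp only: of_real_eq_iff)
  then show ?thesis by (simp add: power2_eq_iff_nonneg)
qed

lemma (in hilbert_space) bounded_linear_scl: "bounded_linear (scl c)"
proof (rule bounded_linear_intro)
  show "scl c (r *\<^sub>R x) = r *\<^sub>R scl c x" for r x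
    by (simp flip: scl_of_real add: mult.commute)
  show "norm (scl c x) \<le> norm x * norm c" for x
    by (simp add: norm_scl)
qed (rule scale_right_distrib)

lemma (in hilbert_space) op_scale_apply:
  "blinfun_apply (op_scale scl c T) x = scl c (blinfun_apply T x)"
  unfolding op_scale_def
  using bounded_linear_compose[OF bounded_linear_scl blinfun.bounded_linear_right]
  by (subst bounded_linear_Blinfun_apply) auto

text \<open>\<open>is_adjoint ip T S\<close>: the (unique) adjoint of \<open>T\<close> is \<open>S\<close>.\<close>

definition is_adjoint ::
  "('a \<Rightarrow> 'a \<Rightarrow> 'k) \<Rightarrow> ('a::{real_inner,complete_space} \<Rightarrow>\<^sub>L 'a) \<Rightarrow> ('a \<Rightarrow>\<^sub>L 'a) \<Rightarrow> bool" where
  "is_adjoint ip T S \<longleftrightarrow>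
     (\<forall>x y. ip (blinfun_apply T x) y = ip x (blinfun_apply S y))"

definition self_adjoint ::
  "('a \<Rightarrow> 'a \<Rightarrow> 'k) \<Rightarrow> ('a::{real_inner,complete_space} \<Rightarrow>\<^sub>L 'a) \<Rightarrow> bool" where
  "self_adjoint ip T \<longleftrightarrow> is_adjoint ip T T"

definition cstar_subalgebra ::
  "('k::rc_field \<Rightarrow> 'a::{real_inner,complete_space} \<Rightarrow> 'a) \<Rightarrow> ('a \<Rightarrow> 'a \<Rightarrow> 'k) \<Rightarrow>
   ('a \<Rightarrow>\<^sub>L 'a) set \<Rightarrow> bool" where
  "cstar_subalgebra scl ip A \<longleftrightarrow>
     A \<subseteq> bounded_ops scl \<and>
     0 \<in> A \<and>
     (\<forall>S\<in>A. \<forall>T\<in>A. S + T \<in> A) \<and>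
     (\<forall>c. \<forall>T\<in>A. op_scale scl c T \<in> A) \<and>
     (\<forall>S\<in>A. \<forall>T\<in>A. S o\<^sub>L T \<in> A) \<and>
     (\<forall>T\<in>A. \<exists>S\<in>A. is_adjoint ip T S) \<and>
     closed A"


section \<open>Real rank zero\<close>

definition is_unit_of :: "('a::real_normed_vector \<Rightarrow>\<^sub>L 'a) set \<Rightarrow> ('a \<Rightarrow>\<^sub>L 'a) \<Rightarrow> bool" where
  "is_unit_of A e \<longleftrightarrow> e \<in> A \<and> (\<forall>a\<in>A. e o\<^sub>L a = a \<and> a o\<^sub>L e = a)"

text \<open>
  The unit of \<open>A\<close>, if there is one, need not be the identity of the Hilbert space. If there
  is none, the identity is not in \<open>A\<close>, and the unitization of \<open>A\<close> is realised
  as the span of \<open>A\<close> and the identity.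
\<close>

definition unitization ::
  "('k::rc_field \<Rightarrow> 'a::{real_inner,complete_space} \<Rightarrow> 'a) \<Rightarrow>
   ('a \<Rightarrow>\<^sub>L 'a) set \<Rightarrow> ('a \<Rightarrow>\<^sub>L 'a) set" where
  "unitization scl A =
     (if \<exists>e. is_unit_of A e then A
      else {a + op_scale scl c id_blinfun | a c. a \<in> A})"

definition invertible_in :: "('a::real_normed_vector \<Rightarrow>\<^sub>L 'a) set \<Rightarrow> ('a \<Rightarrow>\<^sub>L 'a) \<Rightarrow> bool" where
  "invertible_in A a \<longleftrightarrow>
     a \<in> A \<and> (\<exists>e. is_unit_of A e \<and> (\<exists>b\<in>A. a o\<^sub>L b = e \<and> b o\<^sub>L a = e))"

definition real_rank_zero ::
  "('k::rc_field \<Rightarrow> 'a::{real_inner,complete_space} \<Rightarrow> 'a) \<Rightarrow> ('a \<Rightarrow> 'a \<Rightarrow> 'k) \<Rightarrow>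
   ('a \<Rightarrow>\<^sub>L 'a) set \<Rightarrow> bool" where
  "real_rank_zero scl ip A \<longleftrightarrow>
     {a \<in> unitization scl A. self_adjoint ip a}
       \<subseteq> closure {a \<in> unitization scl A. self_adjoint ip a \<and> invertible_in (unitization scl A) a}"


section \<open>Projections\<close>

definition projections ::
  "('a \<Rightarrow> 'a \<Rightarrow> 'k) \<Rightarrow> ('a::{real_inner,complete_space} \<Rightarrow>\<^sub>L 'a) set \<Rightarrow> ('a \<Rightarrow>\<^sub>L 'a) set" where
  "projections ip A = {P \<in> A. self_adjoint ip P \<and> P o\<^sub>L P = P}"

definition proj_le :: "('a::real_normed_vector \<Rightarrow>\<^sub>L 'a) \<Rightarrow> ('a \<Rightarrow>\<^sub>L 'a) \<Rightarrow> bool" where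
  "proj_le P Q \<longleftrightarrow> P o\<^sub>L Q = P"

text \<open>
  The bounds are taken among the projections of all of B(H), not just those of \<open>A\<close>. They
  always exist, as the projections onto the intersection of the ranges and onto the closure of
  their sum, and are unique because \<open>proj_le\<close> is antisymmetric on projections.
\<close>

definition proj_meet ::
  "('k::rc_field \<Rightarrow> 'a::{real_inner,complete_space} \<Rightarrow> 'a) \<Rightarrow> ('a \<Rightarrow> 'a \<Rightarrow> 'k) \<Rightarrow>
   ('a \<Rightarrow>\<^sub>L 'a) \<Rightarrow> ('a \<Rightarrow>\<^sub>L 'a) \<Rightarrow> ('a \<Rightarrow>\<^sub>L 'a)" where
  "proj_meet scl ip P Q =
     (THE R. R \<in> projections ip (bounded_ops scl) \<and> proj_le R P \<and> proj_le R Q \<and>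
        (\<forall>S \<in> projections ip (bounded_ops scl). proj_le S P \<and> proj_le S Q \<longrightarrow> proj_le S R))"

definition proj_join ::
  "('k::rc_field \<Rightarrow> 'a::{real_inner,complete_space} \<Rightarrow> 'a) \<Rightarrow> ('a \<Rightarrow> 'a \<Rightarrow> 'k) \<Rightarrow>
   ('a \<Rightarrow>\<^sub>L 'a) \<Rightarrow> ('a \<Rightarrow>\<^sub>L 'a) \<Rightarrow> ('a \<Rightarrow>\<^sub>L 'a)" where
  "proj_join scl ip P Q =
     (THE R. R \<in> projections ip (bounded_ops scl) \<and> proj_le P R \<and> proj_le Q R \<and>
        (\<forall>S \<in> projections ip (bounded_ops scl). proj_le P S \<and> proj_le Q S \<longrightarrow> proj_le R S))"

text \<open>Here \<open>z\<close> is the minimum of the set \<open>X\<close> ordered by \<open>le\<close>.\<close>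

definition sigma_closed :: "'p set \<Rightarrow> ('p \<Rightarrow> 'p \<Rightarrow> bool) \<Rightarrow> 'p \<Rightarrow> bool" where
  "sigma_closed X le z \<longleftrightarrow>
     (\<forall>p :: nat \<Rightarrow> 'p.
        (\<forall>n. p n \<in> X \<and> p n \<noteq> z) \<and> (\<forall>n. le (p (Suc n)) (p n)) \<longrightarrow>
        (\<exists>q\<in>X. q \<noteq> z \<and> (\<forall>n. le q (p n))))"

end

(*
  Everything is read off the real part of the inner product, because a scalar-linear operator is
  self-adjoint for ip iff it is symmetric for the real inner product.

  The heart is the claim that two projections P, Q of A without a non-zero common lower bound in A
  have a positive angle, norm (P Q) < 1. Otherwise there are unit vectors x_k = Q x_k with
  x_k - P x_k --> 0. Real rank zero passes to corners, by Schur complements, and provides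
  approximate spectral projections inside A; with these one builds projections Q = p_0 >= p_1 >= ...
  in A such that P is within 1/n of the identity on the range of p_n while x_k - p_n x_k --> 0 for
  each n, which keeps p_n non-zero. A non-zero lower bound of the p_n lies below both P and Q.

  If norm (P Q) < 1, the operator Q - Q P Q is invertible in the corner of Q, so the range projection
  of (1 - P) Q, and hence the join of P and Q, lies in A. If M is the meet of P and Q and M is in A,
  then this applies to P - M and Q - M; if J is the join and J is in A, it applies to J - P and J - Q,
  whose join is J - M.
*)
theory Submission imports Defs begin

section \<open>Operators on a real Hilbert space\<close>

text \<open>The positive angle is the crux because \<open>A\<close> is only norm closed: if
  \<open>P Q\<close> has norm 1, the range projection of \<open>(1 - P) Q\<close> is in general just
  a strong limit of elements of \<open>A\<close>. Real rank zero yields projections inside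
  \<open>A\<close>, and sigma-closure turns a decreasing sequence of them into a single one.
  Inverses, square roots and signs are taken only of operators with a spectral gap at 0. There they
  come from fixed points of contractions on norm-closed sets, so they stay in the algebra, and no
  spectral theorem is involved: the argument is the same for real and complex scalars. The identity
  may be missing from \<open>A\<close>. Hence complements are formed relative to a projection, and
  inverses are inverses in its corner.\<close>

text \<open>
  The library's \<open>banach\<close> instance for bounded operators does not apply: the sort
  \<open>{real_inner, complete_space}\<close> is not a subsort of \<open>banach\<close>.
\<close>

lemma complete_UNIV_blinfun:
  "complete (UNIV :: ('a::real_normed_vector \<Rightarrow>\<^sub>L 'b::{real_inner,complete_space}) set)"
proof (rule completeI)
  fix X :: "nat \<Rightarrow> 'a \<Rightarrow>\<^sub>L 'b"
  assume X: "Cauchy X"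
  have "Cauchy (\<lambda>n. X n x)" for x
    by (rule bounded_linear.Cauchy[OF blinfun.bounded_linear_left X])
  then obtain v where v: "\<And>x. (\<lambda>n. X n x) \<longlonglongrightarrow> v x"
    unfolding Cauchy_convergent_iff convergent_def by metis
  obtain K where K: "\<And>n. norm (X n) \<le> K"
    using cauchy_imp_bounded[OF X] by (auto simp: bounded_iff)
  have "bounded_linear v"
  proof (rule bounded_linear_intro)
    show "v (x + y) = v x + v y" for x y
      using tendsto_add[OF v[of x] v[of y]] v[of "x + y"]
      by (simp add: blinfun.add_right LIMSEQ_unique)
    show "v (r *\<^sub>R x) = r *\<^sub>R v x" for r x
      using tendsto_scaleR[OF tendsto_const[of r] v[of x]] v[of "r *\<^sub>R x"]
      by (simp add: blinfun.scaleR_right LIMSEQ_unique)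
    show "norm (v x) \<le> norm x * K" for x
    proof (rule tendsto_upperbound[OF tendsto_norm[OF v[of x]]])
      have "norm (X n x) \<le> norm x * K" for n
        using norm_blinfun[of "X n" x] mult_right_mono[OF K[of n] norm_ge_zero[of x]]
        by (simp add: mult.commute)
      then show "\<forall>\<^sub>F n in sequentially. norm (X n x) \<le> norm x * K" by simp
    qed simp
  qed
  then have Bv: "(\<lambda>n. X n x) \<longlonglongrightarrow> Blinfun v x" for x
    by (simp add: bounded_linear_Blinfun_apply v)
  have "X \<longlonglongrightarrow> Blinfun v"
  proof (rule LIMSEQ_I)
    fix r :: real assume r: "r > 0"
    then obtain M where M: "\<And>m n. m \<ge> M \<Longrightarrow> n \<ge> M \<Longrightarrow> norm (X m - X n) < r / 2"
      using CauchyD[OF X, of "r / 2"] by auto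
    have "norm (X n - Blinfun v) < r" if n: "n \<ge> M" for n
    proof -
      have "norm ((X n - Blinfun v) x) \<le> r / 2 * norm x" for x
      proof (rule tendsto_upperbound)
        show "(\<lambda>m. norm (X n x - X m x)) \<longlonglongrightarrow> norm ((X n - Blinfun v) x)"
          unfolding blinfun.diff_left by (intro tendsto_intros Bv)
        show "\<forall>\<^sub>F m in sequentially. norm (X n x - X m x) \<le> r / 2 * norm x"
          using eventually_ge_at_top[of M]
        proof eventually_elim
          case (elim m)
          have "norm ((X n - X m) x) \<le> norm (X n - X m) * norm x" by (rule norm_blinfun)
          also have "\<dots> \<le> r / 2 * norm x"
            using M[OF n elim] by (intro mult_right_mono) auto
          finally show ?case by (simp add: blinfun.diff_left)
        qed
      qed simp
      then have "norm (X n - Blinfun v) \<le> r / 2" using r by (intro norm_blinfun_bound) auto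
      then show ?thesis using r by simp
    qed
    then show "\<exists>no. \<forall>n\<ge>no. norm (X n - Blinfun v) < r" by blast
  qed
  then show "\<exists>l\<in>UNIV. X \<longlonglongrightarrow> l" by blast
qed

text \<open>The closed set \<open>S\<close> carries the invariants: every closed condition that the
  iteration preserves (membership in the algebra, symmetry, commutation) is inherited by the fixed
  point.\<close>

lemma contraction_fixpoint:
  fixes S :: "('a::real_normed_vector \<Rightarrow>\<^sub>L 'b::{real_inner,complete_space}) set"
  assumes "closed S" "T0 \<in> S" "0 \<le> g" "g < 1" "\<And>T. T \<in> S \<Longrightarrow> f T \<in> S"
    and "\<And>T U. T \<in> S \<Longrightarrow> U \<in> S \<Longrightarrow> norm (f T - f U) \<le> g * norm (T - U)"
  obtains T where "T \<in> S" "f T = T"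
proof -
  have "complete S"
    using complete_closed_subset[OF assms(1) _ complete_UNIV_blinfun] by blast
  then have "\<exists>!T. T \<in> S \<and> f T = T"
    using assms by (intro Banach_fix[of S g f]) (auto simp: dist_norm)
  then show thesis using that by blast
qed

section \<open>Symmetric operators and projections\<close>

definition symm :: "('a::real_inner \<Rightarrow>\<^sub>L 'a) \<Rightarrow> bool" where
  "symm T \<longleftrightarrow> (\<forall>x y. T x \<bullet> y = x \<bullet> T y)"

definition is_proj :: "('a::real_inner \<Rightarrow>\<^sub>L 'a) \<Rightarrow> bool" where
  "is_proj P \<longleftrightarrow> symm P \<and> P o\<^sub>L P = P"

lemma symmD: "symm T \<Longrightarrow> T x \<bullet> y = x \<bullet> T y"
  by (simp add: symm_def)

lemma symm_simps [simp, intro]: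
  "symm 0" "symm id_blinfun" "symm S \<Longrightarrow> symm T \<Longrightarrow> symm (S + T)"
  "symm S \<Longrightarrow> symm T \<Longrightarrow> symm (S - T)" "symm T \<Longrightarrow> symm (r *\<^sub>R T)"
  by (auto simp: symm_def blinfun.bilinear_simps inner_simps)

lemma symm_compose: "symm S \<Longrightarrow> symm T \<Longrightarrow> S o\<^sub>L T = T o\<^sub>L S \<Longrightarrow> symm (S o\<^sub>L T)"
  unfolding symm_def by (metis blinfun_apply_blinfun_compose)

lemma symm_conj: "symm S \<Longrightarrow> symm T \<Longrightarrow> symm (S o\<^sub>L T o\<^sub>L S)"
  by (simp add: symm_def)

text \<open>Take adjoints on both sides. This mirrors one-sided identities, for instance
  \<open>P Q = P\<close> into \<open>Q P = P\<close>.\<close>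

lemma symm_swap:
  assumes "symm S" "symm T" "symm U" "S o\<^sub>L T = U"
  shows "T o\<^sub>L S = U"
proof (rule blinfun_eqI)
  fix x
  have "(T o\<^sub>L S) x \<bullet> y = U x \<bullet> y" for y
  proof -
    have "(T o\<^sub>L S) x \<bullet> y = x \<bullet> (S o\<^sub>L T) y" using assms(1,2) by (simp add: symmD)
    then show ?thesis using assms(3,4) by (simp add: symmD)
  qed
  then have "((T o\<^sub>L S) x - U x) \<bullet> ((T o\<^sub>L S) x - U x) = 0" by (simp add: inner_diff_left)
  then show "(T o\<^sub>L S) x = U x" by simp
qed

lemma comp_apply_eq: "S o\<^sub>L T = U \<Longrightarrow> S (T x) = U x"
  by (metis blinfun_apply_blinfun_compose)

lemma is_projD:
  assumes "is_proj P"
  shows "symm P" "P o\<^sub>L P = P" "P (P x) = P x" "P x \<bullet> y = x \<bullet> P y"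
    "x \<bullet> P x = (norm (P x))\<^sup>2" "P x \<bullet> x = (norm (P x))\<^sup>2"
  using assms unfolding is_proj_def symm_def
  by (auto simp: comp_apply_eq power2_norm_eq_inner)

lemma is_proj_pythagoras:
  assumes "is_proj P"
  shows "(norm (x - P x))\<^sup>2 = (norm x)\<^sup>2 - (norm (P x))\<^sup>2"
  using is_projD(5,6)[OF assms, of x]
  by (simp add: power2_norm_eq_inner inner_simps)

lemma norm_proj_le:
  assumes "is_proj P" shows "norm (P x) \<le> norm x"
proof (rule power2_le_imp_le)
  have "0 \<le> (norm (x - P x))\<^sup>2" by simp
  then show "(norm (P x))\<^sup>2 \<le> (norm x)\<^sup>2" using is_proj_pythagoras[OF assms] by simp
qed simp

lemma norm_le_of_quadratic_form:
  assumes z: "symm z" and g: "g > 0"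
    and pos: "\<And>x. 0 \<le> z x \<bullet> x" and le: "\<And>x. z x \<bullet> x \<le> g * (norm x)\<^sup>2"
  shows "norm z \<le> g"
proof (rule norm_blinfun_bound)
  fix x
  \<comment> \<open>With this test vector, the upper bound on the form at \<open>x\<close> and at
    \<open>z x\<close> leaves g |x|^2 - |z x|^2 / g, which must therefore be nonnegative.\<close>
  have "0 \<le> z (x - (1/g) *\<^sub>R z x) \<bullet> (x - (1/g) *\<^sub>R z x)" by (rule pos)
  also have "\<dots> = z x \<bullet> x - 2 / g * (norm (z x))\<^sup>2 + (1/g)\<^sup>2 * (z (z x) \<bullet> z x)"
    using symmD[OF z, of "z x" x]
    by (simp add: blinfun.bilinear_simps inner_diff_left inner_diff_right dot_square_norm
        power2_eq_square algebra_simps)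
  also have "\<dots> \<le> g * (norm x)\<^sup>2 - 2 / g * (norm (z x))\<^sup>2 + (1/g)\<^sup>2 * (g * (norm (z x))\<^sup>2)"
    using le[of x] le[of "z x"] by (intro add_mono diff_right_mono mult_left_mono) auto
  also have "\<dots> = (g\<^sup>2 * (norm x)\<^sup>2 - (norm (z x))\<^sup>2) / g"
    using g by (simp add: field_simps power2_eq_square)
  finally have "(norm (z x))\<^sup>2 \<le> (g * norm x)\<^sup>2"
    using g by (simp add: zero_le_divide_iff power_mult_distrib)
  then show "norm (z x) \<le> g * norm x"
    by (rule power2_le_imp_le) (use g in simp)
qed (use g in simp)

lemma is_projI: "symm P \<Longrightarrow> (\<And>x. P (P x) = P x) \<Longrightarrow> is_proj P"
  by (simp add: is_proj_def blinfun_eqI)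

lemma blinfun_compose_assoc: "R o\<^sub>L S o\<^sub>L T = R o\<^sub>L (S o\<^sub>L T)"
  by (simp add: blinfun_eqI)

lemma blinfun_compose_id: "id_blinfun o\<^sub>L S = S" "S o\<^sub>L id_blinfun = S"
  by (simp_all add: blinfun_eqI)

lemmas blinfun_compose_distribs =
  bounded_bilinear.diff_left[OF bounded_bilinear_blinfun_compose]
  bounded_bilinear.diff_right[OF bounded_bilinear_blinfun_compose]
  bounded_bilinear.add_left[OF bounded_bilinear_blinfun_compose]
  bounded_bilinear.add_right[OF bounded_bilinear_blinfun_compose]

section \<open>Corners of closed operator algebras\<close>

locale op_algebra =
  fixes B :: "('a::{real_inner,complete_space} \<Rightarrow>\<^sub>L 'a) set"
  assumes closed_B: "closed B"
    and zero_mem: "0 \<in> B"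
    and add_mem: "S \<in> B \<Longrightarrow> T \<in> B \<Longrightarrow> S + T \<in> B"
    and scaleR_mem: "T \<in> B \<Longrightarrow> r *\<^sub>R T \<in> B"
    and compose_mem: "S \<in> B \<Longrightarrow> T \<in> B \<Longrightarrow> S o\<^sub>L T \<in> B"
begin

lemma diff_mem: "S \<in> B \<Longrightarrow> T \<in> B \<Longrightarrow> S - T \<in> B"
  using add_mem[of S "(-1) *\<^sub>R T"] scaleR_mem[of T "-1"] by simp

text \<open>Only the symmetric part of \<open>p B p\<close>; the one-sided condition suffices
  because \<open>symm_swap\<close> supplies \<open>T p = T\<close> when \<open>p\<close> is a
  projection.\<close>

definition corner where
  "corner p = {T \<in> B. symm T \<and> p o\<^sub>L T = T}"

lemma cornerD:
  assumes "is_proj p" "T \<in> corner p"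
  shows "T \<in> B" "symm T" "p o\<^sub>L T = T" "T o\<^sub>L p = T" "p (T x) = T x" "T (p x) = T x"
    "T x \<bullet> y = x \<bullet> T y"
proof -
  show "T \<in> B" "symm T" "p o\<^sub>L T = T" using assms by (auto simp: corner_def)
  then show "T o\<^sub>L p = T" using symm_swap is_projD(1)[OF assms(1)] by blast
  then show "p (T x) = T x" "T (p x) = T x" "T x \<bullet> y = x \<bullet> T y"
    using \<open>p o\<^sub>L T = T\<close> \<open>symm T\<close> by (auto simp: comp_apply_eq symmD)
qed

section \<open>Inverses, square roots and signs in a corner\<close>

lemma corner_bound:
  assumes p: "is_proj p" "p \<in> B" and t: "t \<in> corner p" and k: "k > 0"
    and low: "\<And>x. k * (norm (p x))\<^sup>2 \<le> t x \<bullet> x"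
  obtains L g where "L > 0" "0 < g" "g < 1" "norm (p - (1/L) *\<^sub>R t) \<le> g"
    "p - (1/L) *\<^sub>R t \<in> corner p"
proof -
  \<comment> \<open>\<open>L \<ge> norm t\<close> makes \<open>p - t / L\<close> positive. The
    summand \<open>2 * k\<close> keeps \<open>k / L\<close> at most 1/2, so \<open>1 - k / L\<close>
    lies strictly between 0 and 1 even if \<open>p = 0\<close>.\<close>
  define L where "L = norm t + 2 * k"
  define z where "z = p - (1/L) *\<^sub>R t"
  have L: "L > 0" "2 * k \<le> L" using k by (auto simp: L_def add_nonneg_pos)
  note td = cornerD[OF p(1) t]
  have sz: "symm z" using td(2) is_projD(1)[OF p(1)] by (auto simp: z_def)
  have zx: "z x \<bullet> x = (norm (p x))\<^sup>2 - (t x \<bullet> x) / L" for x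
    using is_projD(6)[OF p(1)] by (simp add: z_def blinfun.bilinear_simps inner_simps)
  have up: "t x \<bullet> x \<le> L * (norm (p x))\<^sup>2" for x
  proof -
    have "t x \<bullet> x = t (p x) \<bullet> p x" using td(5,6,7) by (metis)
    also have "\<dots> \<le> norm (t (p x)) * norm (p x)" by (rule norm_cauchy_schwarz)
    also have "\<dots> \<le> (norm t * norm (p x)) * norm (p x)"
      by (intro mult_right_mono norm_blinfun) auto
    also have "\<dots> \<le> L * (norm (p x))\<^sup>2"
      using k by (simp add: L_def power2_eq_square distrib_right)
    finally show ?thesis .
  qed
  have "norm z \<le> 1 - k / L"
  proof (rule norm_le_of_quadratic_form[OF sz])
    show "0 < 1 - k / L" using L k by (simp add: field_simps)
    show "0 \<le> z x \<bullet> x" for x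
      using up[of x] L by (simp add: zx field_simps)
    show "z x \<bullet> x \<le> (1 - k / L) * (norm x)\<^sup>2" for x
    proof -
      have "z x \<bullet> x \<le> (1 - k / L) * (norm (p x))\<^sup>2"
        using low[of x] L by (simp add: zx field_simps)
      also have "\<dots> \<le> (1 - k / L) * (norm x)\<^sup>2"
        using L k norm_proj_le[OF p(1), of x] by (intro mult_left_mono power_mono) (auto simp: field_simps)
      finally show ?thesis .
    qed
  qed
  moreover have "z \<in> corner p"
    using sz p(2) td(1) is_projD(3)[OF p(1)] td(5)
    by (auto simp: corner_def z_def diff_mem scaleR_mem blinfun.bilinear_simps intro!: blinfun_eqI)
  ultimately show thesis
    using that[of L "1 - k / L"] L k by (auto simp: z_def field_simps)
qed

lemma corner_inverse:
  assumes p: "is_proj p" "p \<in> B" and t: "t \<in> corner p" and k: "k > 0"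
    and low: "\<And>x. k * (norm (p x))\<^sup>2 \<le> t x \<bullet> x"
  obtains c where "c \<in> corner p" "t o\<^sub>L c = p" "c o\<^sub>L t = p"
proof -
  obtain L g where L: "L > 0" "0 < g" "g < 1" "norm (p - (1/L) *\<^sub>R t) \<le> g"
    "p - (1/L) *\<^sub>R t \<in> corner p"
    using corner_bound[OF assms] by blast
  define z where "z = p - (1/L) *\<^sub>R t"
  note zd = cornerD[OF p(1) L(5)[folded z_def]]
  note pd = is_projD[OF p(1)]
  note td = cornerD[OF p(1) t]
  \<comment> \<open>Symmetry is not imposed on \<open>?S\<close>, since \<open>z T\<close> need not
    be symmetric when \<open>T\<close> is. It is recovered for \<open>c\<close> from
    \<open>t c = p\<close> and the symmetry of \<open>t\<close> and \<open>p\<close>.\<close>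
  let ?S = "B \<inter> {T. p o\<^sub>L T = T}"
  have "closed {T. p o\<^sub>L T = T}"
    by (intro closed_Collect_eq continuous_intros bounded_bilinear.continuous_on[OF bounded_bilinear_blinfun_compose])
  then have "closed ?S" using closed_B by blast
  moreover have "p \<in> ?S" using p(2) pd(2) by simp
  moreover have "p + (z o\<^sub>L T) \<in> ?S" if T: "T \<in> ?S" for T
  proof -
    have "p (T x) = T x" for x using T by (simp add: comp_apply_eq)
    then have "p o\<^sub>L (p + (z o\<^sub>L T)) = p + (z o\<^sub>L T)"
      by (intro blinfun_eqI) (simp add: blinfun.bilinear_simps pd(3) zd(5))
    then show ?thesis using p(2) zd(1) T by (auto intro: add_mem compose_mem)
  qed
  moreover have "norm ((p + (z o\<^sub>L S)) - (p + (z o\<^sub>L T))) \<le> g * norm (S - T)" for S T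
  proof -
    have "norm ((z o\<^sub>L S) - (z o\<^sub>L T)) = norm (z o\<^sub>L (S - T))"
      by (simp add: bounded_bilinear.diff_right[OF bounded_bilinear_blinfun_compose])
    also have "\<dots> \<le> norm z * norm (S - T)" by (rule norm_blinfun_compose)
    also have "\<dots> \<le> g * norm (S - T)" using L(4) by (intro mult_right_mono) (auto simp: z_def)
    finally show ?thesis by simp
  qed
  \<comment> \<open>The fixed point of \<open>T \<mapsto> p + z T\<close> inverts \<open>p - z = t / L\<close>.\<close>
  ultimately obtain d where d: "d \<in> ?S" "p + (z o\<^sub>L d) = d"
    using contraction_fixpoint[of ?S p g "\<lambda>T. p + (z o\<^sub>L T)"] L by (metis (no_types, lifting) less_imp_le)
  define c where "c = (1/L) *\<^sub>R d"
  have cB: "c \<in> B" and pc: "p o\<^sub>L c = c"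
    using d scaleR_mem by (auto simp: c_def bounded_bilinear.scaleR_right[OF bounded_bilinear_blinfun_compose])
  have tc: "t o\<^sub>L c = p"
  proof (rule blinfun_eqI)
    fix x
    have "p (d x) = d x" using d by (simp add: comp_apply_eq)
    moreover have "d x = p x + z (d x)" using d(2) by (metis blinfun.add_left blinfun_apply_blinfun_compose)
    ultimately have "(1/L) *\<^sub>R t (d x) = p x" by (simp add: z_def blinfun.bilinear_simps)
    then show "(t o\<^sub>L c) x = p x" by (simp add: c_def blinfun.bilinear_simps)
  qed
  have sc: "symm c" unfolding symm_def
  proof (intro allI)
    fix x y
    have "c x \<bullet> y = p (c x) \<bullet> y" using pc by (simp add: comp_apply_eq)
    also have "\<dots> = c x \<bullet> t (c y)" by (simp add: comp_apply_eq[OF tc] pd(4))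
    also have "\<dots> = t (c x) \<bullet> c y" by (rule td(7)[symmetric])
    also have "\<dots> = x \<bullet> p (c y)" by (simp add: comp_apply_eq[OF tc] pd(4))
    also have "\<dots> = x \<bullet> c y" using pc by (simp add: comp_apply_eq)
    finally show "c x \<bullet> y = x \<bullet> c y" .
  qed
  show thesis
    using that[of c] cB pc tc sc symm_swap[OF td(2) sc pd(1) tc] by (auto simp: corner_def)
qed

text \<open>Commutation with \<open>y\<close> is one of the closed invariants of the iteration. In
  the application \<open>t = y^2\<close>, and the root plays the role of the absolute value of
  \<open>y\<close>.\<close>

lemma corner_sqrt:
  assumes p: "is_proj p" "p \<in> B" and t: "t \<in> corner p" and k: "k > 0"
    and low: "\<And>x. k * (norm (p x))\<^sup>2 \<le> t x \<bullet> x"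
    and y: "y o\<^sub>L t = t o\<^sub>L y" "y o\<^sub>L p = p o\<^sub>L y"
  obtains s k' where "s \<in> corner p" "s o\<^sub>L s = t" "y o\<^sub>L s = s o\<^sub>L y"
    "k' > 0" "\<And>x. k' * (norm (p x))\<^sup>2 \<le> s x \<bullet> x"
proof -
  obtain L g where L: "L > 0" "0 < g" "g < 1" "norm (p - (1/L) *\<^sub>R t) \<le> g"
    "p - (1/L) *\<^sub>R t \<in> corner p"
    using corner_bound[OF p t k low] by blast
  define z where "z = p - (1/L) *\<^sub>R t"
  \<comment> \<open>The quadratic iteration below maps the ball of radius \<rho> into itself if (g +
    \<rho>^2) / 2 \<le> \<rho>. The smaller root of the equality is \<open>1 - b\<close>, and on
    that ball the map contracts by the factor \<open>1 - b\<close>.\<close>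
  define b where "b = sqrt (1 - g)"
  have b: "0 < b" "b < 1" "g = 1 - b\<^sup>2" using L by (auto simp: b_def)
  note zc = L(5)[folded z_def]
  note zd = cornerD[OF p(1) zc]
  note pd = is_projD[OF p(1)]
  note td = cornerD[OF p(1) t]
  have yz: "y o\<^sub>L z = z o\<^sub>L y"
    using y by (simp add: z_def bounded_bilinear.diff_right[OF bounded_bilinear_blinfun_compose]
      bounded_bilinear.diff_left[OF bounded_bilinear_blinfun_compose]
      bounded_bilinear.scaleR_right[OF bounded_bilinear_blinfun_compose]
      bounded_bilinear.scaleR_left[OF bounded_bilinear_blinfun_compose])
  let ?S = "B \<inter> {T. symm T} \<inter> {T. p o\<^sub>L T = T} \<inter> {T. y o\<^sub>L T = T o\<^sub>L y} \<inter> cball 0 (1 - b)"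
  \<comment> \<open>A fixed point \<open>X\<close> satisfies \<open>(p - X)\<^sup>2 = p - z = t / L\<close>; since \<open>norm X < 1\<close>, the root
     \<open>p - X\<close> is automatically positive.\<close>
  let ?f = "\<lambda>T. (1/2) *\<^sub>R (z + (T o\<^sub>L T))"
  have "closed {T. p o\<^sub>L T = T}" "closed {T. y o\<^sub>L T = T o\<^sub>L y}"
    by (intro closed_Collect_eq continuous_intros bounded_bilinear.continuous_on[OF bounded_bilinear_blinfun_compose])+
  moreover have "closed {T::'a \<Rightarrow>\<^sub>L 'a. symm T}"
    unfolding symm_def by (intro closed_Collect_all closed_Collect_eq continuous_intros)
  ultimately have "closed ?S" using closed_B by (intro closed_Int) auto
  moreover have "0 \<in> ?S" using b zero_mem by (auto intro!: blinfun_eqI simp: blinfun.bilinear_simps)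
  moreover have "?f T \<in> ?S" if T: "T \<in> ?S" for T
  proof (intro IntI)
    have pT: "p (T x) = T x" for x using T by (simp add: comp_apply_eq)
    show "?f T \<in> B" using T zd by (intro scaleR_mem add_mem compose_mem) auto
    show "?f T \<in> {T. symm T}"
      using T zd(2) by (intro CollectI symm_simps symm_compose) auto
    show "?f T \<in> {T. p o\<^sub>L T = T}"
      by (auto simp: blinfun.bilinear_simps pT zd(5) intro!: blinfun_eqI)
    show "?f T \<in> {T. y o\<^sub>L T = T o\<^sub>L y}"
    proof (intro CollectI blinfun_eqI)
      fix x
      have "y (T w) = T (y w)" "y (z w) = z (y w)" for w
        using T yz by (auto, (metis blinfun_apply_blinfun_compose)+)
      then show "(y o\<^sub>L ?f T) x = (?f T o\<^sub>L y) x" by (simp add: blinfun.bilinear_simps)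
    qed
    have "norm (z + (T o\<^sub>L T)) \<le> norm z + norm T * norm T"
      using norm_triangle_ineq norm_blinfun_compose by (meson add_left_mono order_trans)
    also have "\<dots> \<le> (1 - b\<^sup>2) + (1 - b) * (1 - b)"
      using T L(4) b by (intro add_mono mult_mono) (auto simp: z_def)
    also have "\<dots> = 2 * (1 - b)" by (simp add: power2_eq_square algebra_simps)
    finally have "norm (z + (T o\<^sub>L T)) / 2 \<le> 1 - b" by simp
    moreover have "norm (?f T) = norm (z + (T o\<^sub>L T)) / 2" by (simp only: norm_scaleR)
    ultimately show "?f T \<in> cball 0 (1 - b)" by (simp only: mem_cball_0)
  qed
  moreover have "norm (?f S - ?f T) \<le> (1 - b) * norm (S - T)" if "S \<in> ?S" "T \<in> ?S" for S T
  proof -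
    have "(S o\<^sub>L S) - (T o\<^sub>L T) = (S o\<^sub>L (S - T)) + ((S - T) o\<^sub>L T)"
      by (auto intro!: blinfun_eqI simp: blinfun.bilinear_simps)
    then have "norm ((S o\<^sub>L S) - (T o\<^sub>L T)) \<le> norm S * norm (S - T) + norm (S - T) * norm T"
      by (smt (verit) norm_triangle_ineq norm_blinfun_compose)
    also have "\<dots> \<le> (1 - b) * norm (S - T) + norm (S - T) * (1 - b)"
      using that by (intro add_mono mult_right_mono mult_left_mono) auto
    finally show ?thesis
      by (simp flip: scaleR_diff_right)
  qed
  ultimately obtain X where X: "X \<in> ?S" "?f X = X"
    using contraction_fixpoint[of ?S 0 "1 - b" ?f] b by (smt (verit, best))
  define s where "s = sqrt L *\<^sub>R (p - X)"
  have Xp: "p (X x) = X x" "X (p x) = X x" for x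
    using cornerD(5,6)[OF p(1), of X x] X by (auto simp: corner_def)
  have "s \<in> corner p"
    using X p pd(1) Xp
    by (auto simp: pd(3) corner_def s_def blinfun.bilinear_simps intro!: scaleR_mem diff_mem blinfun_eqI)
  moreover have "s o\<^sub>L s = t"
  proof (rule blinfun_eqI)
    fix x
    have "2 *\<^sub>R X x = z x + X (X x)"
      using arg_cong[OF X(2), of "\<lambda>T. 2 *\<^sub>R T x"] by (simp add: blinfun.bilinear_simps)
    then have "p x - X x - (X x - X (X x)) = p x - z x"
      by (simp add: scaleR_2 algebra_simps)
    moreover have "(s o\<^sub>L s) x = (sqrt L * sqrt L) *\<^sub>R (p x - X x - (X x - X (X x)))"
      by (simp add: s_def blinfun.bilinear_simps pd(3) Xp scaleR_diff_right)
    ultimately have "(s o\<^sub>L s) x = L *\<^sub>R (p x - z x)" using L by simp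
    then show "(s o\<^sub>L s) x = t x" using L by (simp add: z_def blinfun.bilinear_simps)
  qed
  moreover have "y o\<^sub>L s = s o\<^sub>L y"
    using X y by (simp add: s_def bounded_bilinear.diff_right[OF bounded_bilinear_blinfun_compose]
      bounded_bilinear.diff_left[OF bounded_bilinear_blinfun_compose]
      bounded_bilinear.scaleR_right[OF bounded_bilinear_blinfun_compose]
      bounded_bilinear.scaleR_left[OF bounded_bilinear_blinfun_compose])
  moreover have "sqrt L * b * (norm (p x))\<^sup>2 \<le> s x \<bullet> x" for x
  proof -
    have "X x \<bullet> x = X (p x) \<bullet> p x"
      using pd(4)[of "X (p x)" x] by (simp add: Xp)
    also have "\<dots> \<le> norm (X (p x)) * norm (p x)" by (rule norm_cauchy_schwarz)
    also have "\<dots> \<le> (norm X * norm (p x)) * norm (p x)"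
      by (intro mult_right_mono norm_blinfun) auto
    also have "\<dots> \<le> ((1 - b) * norm (p x)) * norm (p x)"
      using X by (intro mult_right_mono) auto
    finally have "b * (norm (p x))\<^sup>2 \<le> (norm (p x))\<^sup>2 - X x \<bullet> x"
      by (simp add: power2_eq_square algebra_simps)
    then have "sqrt L * (b * (norm (p x))\<^sup>2) \<le> sqrt L * ((norm (p x))\<^sup>2 - X x \<bullet> x)"
      using L by (intro mult_left_mono) auto
    then show ?thesis
      using pd(6) by (simp add: s_def blinfun.bilinear_simps inner_simps)
  qed
  ultimately show thesis using that[of s "sqrt L * b"] L b by auto
qed


text \<open>By \<open>low\<close>, \<open>y^2 \<ge> p / K^2\<close>: the spectrum of
  \<open>y\<close> in the corner has a gap at 0. The sign of \<open>y\<close> is thus continuous on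
  it, and the spectral projection \<open>r\<close> of the positive half-line stays in the
  norm-closed algebra.\<close>

lemma sign_projection:
  assumes p: "is_proj p" "p \<in> B" and y: "y \<in> corner p" and K: "K > 0"
    and low: "\<And>x. norm (p x) \<le> K * norm (y x)"
  obtains r where "is_proj r" "r \<in> B" "\<And>x. p (r x) = r x" "\<And>x. r (p x) = r x"
    "\<And>x. y (r x) = r (y x)" "\<And>x. 0 \<le> y (r x) \<bullet> r x"
    "\<And>x. y (p x - r x) \<bullet> (p x - r x) \<le> 0"
proof -
  note yd = cornerD[OF p(1) y]
  note pd = is_projD[OF p(1)]
  have t: "y o\<^sub>L y \<in> corner p"
    using yd(1,2,3) by (auto simp: corner_def compose_mem symm_compose simp flip: blinfun_compose_assoc)
  have "(1 / K\<^sup>2) * (norm (p x))\<^sup>2 \<le> (y o\<^sub>L y) x \<bullet> x" for x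
  proof -
    have "(norm (p x))\<^sup>2 \<le> (K * norm (y x))\<^sup>2" by (intro power_mono low) simp
    moreover have "(y o\<^sub>L y) x \<bullet> x = (norm (y x))\<^sup>2"
      using yd(7)[of "y x" x] by (simp add: power2_norm_eq_inner)
    ultimately show ?thesis using K by (simp add: field_simps)
  qed
  moreover have "1 / K\<^sup>2 > 0" using K by simp
  ultimately obtain s k where s: "s \<in> corner p" "s o\<^sub>L s = y o\<^sub>L y" "y o\<^sub>L s = s o\<^sub>L y" "k > 0"
    and slow: "\<And>x. k * (norm (p x))\<^sup>2 \<le> s x \<bullet> x"
    using corner_sqrt[OF p t, of "1 / K\<^sup>2" y] yd(3,4) by (metis blinfun_compose_assoc)
  obtain c where c: "c \<in> corner p" "s o\<^sub>L c = p" "c o\<^sub>L s = p"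
    using corner_inverse[OF p s(1,4) slow] by blast
  note sd = cornerD[OF p(1) s(1)] and cd = cornerD[OF p(1) c(1)]
  have ss: "s (s x) = y (y x)" and ys: "y (s x) = s (y x)" and sc: "s (c x) = p x"
    and cs: "c (s x) = p x" for x
    using s(2,3) c(2,3) by (metis blinfun_apply_blinfun_compose)+
  have cy: "c (y x) = y (c x)" for x
  proof -
    have "c (y x) = c (y (s (c x)))" by (simp add: sc yd(6))
    also have "\<dots> = c (s (y (c x)))" by (simp add: ys)
    finally show ?thesis by (simp add: cs yd(5))
  qed
  \<comment> \<open>\<open>g\<close> is the sign \<open>y / \<bar>y\<bar>\<close>.\<close>
  define g where "g = y o\<^sub>L c"
  have g: "g x = y (c x)" for x by (simp add: g_def)
  have sg: "symm g" unfolding g_def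
    using yd(2) cd(2) by (rule symm_compose) (auto intro!: blinfun_eqI simp: cy)
  have gg: "g (g x) = p x" for x
  proof -
    have "g (g x) = y (y (c (c x)))" by (simp add: g cy)
    also have "\<dots> = s (s (c (c x)))" by (simp add: ss)
    finally show ?thesis by (simp add: sc cd(5))
  qed
  have yg: "y (g x) = s x" "g (y x) = s x" for x
    by (simp_all add: g cy flip: ss) (simp_all add: sc sd(6))
  have gp: "g (p x) = g x" "p (g x) = g x" for x
    by (simp_all add: g cd(6) yd(5))
  \<comment> \<open>Since \<open>g\<close> is symmetric with \<open>g^2 = p\<close>,
    \<open>r\<close> and \<open>p - r\<close> project onto its eigenspaces for 1 and -1. There
    \<open>y\<close> equals \<open>s\<close> and \<open>- s\<close>, so both sign claims follow from
    the positivity of \<open>s\<close>.\<close>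
  define r where "r = (1/2) *\<^sub>R (p + g)"
  have r: "r x = (1/2) *\<^sub>R (p x + g x)" for x by (simp add: r_def blinfun.bilinear_simps)
  have gr: "g (r x) = r x" for x
    by (simp add: r blinfun.bilinear_simps gg gp)
  have pr: "p (r x) = r x" for x
    by (simp add: r blinfun.bilinear_simps pd(3) gp)
  have gq: "g (p x - r x) = - (p x - r x)" for x
  proof -
    have "p x - r x = (1/2) *\<^sub>R (p x - g x)"
    proof -
      have "2 *\<^sub>R (p x - r x) = p x - g x" by (simp add: r scaleR_diff_right scaleR_2)
      then show ?thesis by (metis (no_types) scaleR_half_double scaleR_scaleR scaleR_one
         mult.commute nonzero_eq_divide_eq zero_neq_numeral)
    qed
    then show ?thesis by (simp add: blinfun.bilinear_simps gg gp flip: scaleR_minus_right)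
  qed
  show thesis
  proof (rule that[of r])
    show "is_proj r"
    proof (rule is_projI)
      show "symm r" using sg pd(1) by (simp add: r_def)
      show "r (r x) = r x" for x
        using r[of "r x"] by (simp add: gr pr)
    qed
    show "r \<in> B" using p(2) yd(1) cd(1) by (simp add: r_def g_def scaleR_mem add_mem compose_mem)
    show "p (r x) = r x" "r (p x) = r x" for x by (simp_all add: r blinfun.bilinear_simps pd(3) gp)
    show "y (r x) = r (y x)" for x
      by (simp add: r blinfun.bilinear_simps yg yd(5,6))
    show "0 \<le> y (r x) \<bullet> r x" for x
    proof -
      have "y (r x) = s (r x)" using yg(1)[of "r x"] by (simp add: gr)
      then show ?thesis using slow[of "r x"] s(4)
        by (metis mult_nonneg_nonneg order_less_imp_le order_trans zero_le_power2)
    qed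
    show "y (p x - r x) \<bullet> (p x - r x) \<le> 0" for x
    proof -
      have "s (p x - r x) = - y (p x - r x)"
        using yg(1)[of "p x - r x"] by (simp only: gq blinfun.minus_right)
      moreover have "0 \<le> s (p x - r x) \<bullet> (p x - r x)"
        using slow[of "p x - r x"] s(4)
        by (metis mult_nonneg_nonneg order_less_imp_le order_trans zero_le_power2)
      ultimately show ?thesis by (simp add: inner_minus_left)
    qed
  qed
qed

text \<open>
  Here \<open>p u p\<close> is the Schur complement, with respect to the block \<open>e - p\<close>, of an invertible
  \<open>b\<close> that is close to \<open>x + (e - p)\<close>; it inherits invertibility from \<open>b\<close>. This is how real
  rank zero passes to the corner of \<open>p\<close>.
\<close>

lemma corner_perturbation:
  assumes p: "is_proj p" "p \<in> B" and e: "is_proj e" "e \<in> B" "p o\<^sub>L e = p"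
    and b: "symm b" "b \<in> B" "e o\<^sub>L b = b" and d: "d o\<^sub>L b = e"
    and x: "x \<in> corner p" and \<delta>: "0 < \<delta>" "\<delta> \<le> 1 / 2" "norm (b - (x + (e - p))) \<le> \<delta>"
  obtains u where "u \<in> B" "p o\<^sub>L u o\<^sub>L p \<in> corner p" "norm (x - (p o\<^sub>L u o\<^sub>L p)) \<le> 2 * \<delta>"
    "\<And>v. norm (p v) \<le> norm d * norm ((p o\<^sub>L u o\<^sub>L p) v)"
proof -
  note pd = is_projD[OF p(1)] and ed = is_projD[OF e(1)] and xd = cornerD[OF p(1) x]
  have pe: "p (e v) = p v" "e (p v) = p v" for v
    using e(3) symm_swap[OF pd(1) ed(1) pd(1) e(3)] by (metis blinfun_apply_blinfun_compose)+
  define q where "q = e - p"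
  have q: "q v = e v - p v" for v by (simp add: q_def blinfun.diff_left)
  have qp: "q (p v) = 0" "p (q v) = 0" for v
    by (simp_all add: q pe pd(3) blinfun.diff_right)
  have eq: "e (q v) = q v" "q (e v) = q v" for v
    by (simp_all add: q pe ed(3) blinfun.diff_right)
  have pq: "is_proj q" 
    using ed(1) pd(1) qp by (intro is_projI) (auto simp: q_def, simp add: blinfun.diff_left blinfun.diff_right ed(3) pe pd(3))
  have qB: "q \<in> B" using e(2) p(2) by (simp add: q_def diff_mem)
  note qd = is_projD[OF pq]
  have xq: "x (q v) = 0" "q (x v) = 0" for v
    using xd(5)[of v] xd(6)[of "q v"] qp by (metis blinfun.zero_right)+
  define g where "g = b - (x + q)"
  have b_eq: "b v = g v + x v + q v" for v by (simp add: g_def blinfun.bilinear_simps)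
  have ng: "norm (g v) \<le> \<delta> * norm v" for v
    using norm_blinfun[of g v] mult_right_mono[OF \<delta>(3) norm_ge_zero[of v]]
    by (simp add: g_def q_def)
  define f where "f = q o\<^sub>L b o\<^sub>L q"
  have f: "f \<in> corner q"
    using qB b qd(2) by (auto simp: corner_def f_def compose_mem symm_conj qd(1) simp flip: blinfun_compose_assoc)
  \<comment> \<open>\<open>x\<close> vanishes on the range of \<open>q\<close>, so the
    \<open>q\<close> block of \<open>b\<close> is within \<delta> \<le> 1/2 of \<open>q\<close>.
    This also bounds its inverse by 2.\<close>
  have low: "(1/2) * (norm (q v))\<^sup>2 \<le> f v \<bullet> v" for v
  proof -
    have "- (g (q v) \<bullet> q v) \<le> norm (g (q v)) * norm (q v)"
      using norm_cauchy_schwarz[of "- g (q v)" "q v"] by simp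
    also have "\<dots> \<le> \<delta> * norm (q v) * norm (q v)" by (intro mult_right_mono ng) simp
    also have "\<dots> \<le> (1/2) * norm (q v) * norm (q v)" using \<delta> by (intro mult_right_mono) auto
    finally have 1: "- (g (q v) \<bullet> q v) \<le> (1/2) * (norm (q v))\<^sup>2" by (simp add: power2_eq_square)
    have "f v \<bullet> v = b (q v) \<bullet> q v" using qd(4) by (simp add: f_def)
    also have "\<dots> = g (q v) \<bullet> q v + (norm (q v))\<^sup>2"
      by (simp add: b_eq xq qd(3) inner_add_left power2_norm_eq_inner)
    finally show ?thesis using 1 by simp
  qed
  obtain c where c: "c \<in> corner q" "f o\<^sub>L c = q" "c o\<^sub>L f = q"
    using corner_inverse[OF pq qB f _ low] by auto
  note cd = cornerD[OF pq c(1)]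
  have fc: "q (b (c v)) = q v" for v
    using comp_apply_eq[OF c(2), of v] by (simp add: f_def cd(5))
  have nc: "norm (c v) \<le> 2 * norm v" for v
  proof -
    have "(1/2) * (norm (c v))\<^sup>2 \<le> f (c v) \<bullet> c v" using low[of "c v"] by (simp add: cd(5))
    also have "\<dots> = v \<bullet> c v" using comp_apply_eq[OF c(2), of v] qd(4)[of v "c v"] by (simp add: cd(5))
    also have "\<dots> \<le> norm v * norm (c v)" by (rule norm_cauchy_schwarz)
    finally have "norm (c v) * norm (c v) \<le> (2 * norm v) * norm (c v)" by (simp add: power2_eq_square)
    then show ?thesis by (cases "c v = 0") auto
  qed
  have cx: "c (x v) = 0" "x (c v) = 0" "c (p v) = 0" "p (c v) = 0" "e (c v) = c v" for v
    using cd(5,6) xq qp eq by (metis blinfun.zero_right)+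
  define u where "u = b - (b o\<^sub>L c o\<^sub>L b)"
  define y where "y = p o\<^sub>L u o\<^sub>L p"
  have y: "y v = p (b (p v)) - p (b (c (b (p v))))" for v
    by (simp add: y_def u_def blinfun.bilinear_simps)
  have su: "symm u" using b(1) cd(2) by (simp add: u_def symm_conj)
  have uB: "u \<in> B" using b cd(1) by (simp add: u_def diff_mem compose_mem)
  have "y \<in> corner p"
    using uB su p(2) pd(1,2) by (auto simp: corner_def y_def compose_mem symm_conj simp flip: blinfun_compose_assoc)
  \<comment> \<open>The off-diagonal blocks of \<open>b\<close> are those of \<open>g\<close>, so
    the error is at most \<delta> + 2 \<delta>^2, and \<delta> \<le> 1/2.\<close>
  moreover have "norm (x - y) \<le> 2 * \<delta>"
  proof (rule norm_blinfun_bound)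
    fix v
    have b1: "c (b (p v)) = c (g (p v))" by (simp add: b_eq blinfun.add_right cx qp)
    have b2: "p (b (c w)) = p (g (c w))" for w by (simp add: b_eq blinfun.add_right cx qp)
    have "(x - y) v = p (g (c (g (p v)))) - p (g (p v))"
      by (simp add: blinfun.diff_left y b1 b2) (simp add: b_eq blinfun.add_right qp xd(5,6))
    also have "norm \<dots> \<le> norm (p (g (c (g (p v))))) + norm (p (g (p v)))" by (rule norm_triangle_ineq4)
    also have "\<dots> \<le> \<delta> * (2 * (\<delta> * norm v)) + \<delta> * norm v"
    proof (rule add_mono)
      have gp: "norm (g (p v)) \<le> \<delta> * norm v"
        using ng[of "p v"] mult_left_mono[OF norm_proj_le[OF p(1), of v], of \<delta>] \<delta> by linarith
      then show "norm (p (g (p v))) \<le> \<delta> * norm v" using norm_proj_le[OF p(1)] order_trans by blast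
      have "norm (p (g (c (g (p v))))) \<le> \<delta> * norm (c (g (p v)))"
        using norm_proj_le[OF p(1)] ng order_trans by blast
      also have "\<dots> \<le> \<delta> * (2 * (\<delta> * norm v))"
        using \<delta> nc[of "g (p v)"] gp by (intro mult_left_mono) auto
      finally show "norm (p (g (c (g (p v))))) \<le> \<delta> * (2 * (\<delta> * norm v))" .
    qed
    also have "\<dots> \<le> 2 * \<delta> * norm v"
    proof -
      have "\<delta> * (2 * \<delta> * norm v) \<le> \<delta> * (1 * norm v)"
        using \<delta> by (intro mult_left_mono mult_right_mono) auto
      then show ?thesis by (simp add: algebra_simps)
    qed
    finally show "norm ((x - y) v) \<le> 2 * \<delta> * norm v" .
  qed (use \<delta> in simp)
  moreover have "norm (p v) \<le> norm d * norm (y v)" for v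
  proof -
    \<comment> \<open>The correction by \<open>c\<close> cancels the \<open>q\<close> component of
      \<open>b \<xi>\<close>, so \<open>b \<xi> = y v\<close>. The left inverse \<open>d\<close>
      then bounds \<xi>, whose \<open>p\<close> component is \<open>p v\<close>.\<close>
    define \<xi> where "\<xi> = p v - c (b (p v))"
    have "q (b \<xi>) = 0" by (simp add: \<xi>_def blinfun.diff_right fc)
    moreover have "p (b \<xi>) = y v" by (simp add: \<xi>_def blinfun.diff_right y)
    moreover have "b \<xi> = e (b \<xi>)" using comp_apply_eq[OF b(3)] by simp
    ultimately have "b \<xi> = y v" by (simp add: q)
    moreover have "d (b \<xi>) = \<xi>"
      by (simp add: comp_apply_eq[OF d]) (simp add: \<xi>_def blinfun.diff_right pe cx)
    ultimately have "norm \<xi> \<le> norm d * norm (y v)" using norm_blinfun[of d "y v"] by simp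
    moreover have "p \<xi> = p v" by (simp add: \<xi>_def blinfun.diff_right pd(3) cx)
    then have "norm (p v) \<le> norm \<xi>" using norm_proj_le[OF p(1), of \<xi>] by simp
    ultimately show ?thesis by linarith
  qed
  ultimately show thesis using that[of u] uB by (simp add: y_def)
qed

text \<open>A closed algebra in which to work with the unitization of \<open>B\<close>, so that
  closedness of the unitization itself never has to be shown. Compression by a projection of
  \<open>B\<close> leads back into \<open>B\<close>.\<close>

lemma idealizer: "op_algebra {T. \<forall>a\<in>B. a o\<^sub>L T \<in> B \<and> T o\<^sub>L a \<in> B}"
proof
  have "closed ((\<lambda>T. a o\<^sub>L T) -` B)" "closed ((\<lambda>T. T o\<^sub>L a) -` B)" for a :: "'a \<Rightarrow>\<^sub>L 'a"
    by (intro continuous_closed_vimage[OF closed_B] continuous_intros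
      bounded_bilinear.continuous[OF bounded_bilinear_blinfun_compose])+
  then have "closed (\<Inter>a\<in>B. (\<lambda>T. a o\<^sub>L T) -` B \<inter> (\<lambda>T. T o\<^sub>L a) -` B)" by blast
  moreover have "{T. \<forall>a\<in>B. a o\<^sub>L T \<in> B \<and> T o\<^sub>L a \<in> B} = (\<Inter>a\<in>B. (\<lambda>T. a o\<^sub>L T) -` B \<inter> (\<lambda>T. T o\<^sub>L a) -` B)"
    by auto
  ultimately show "closed {T. \<forall>a\<in>B. a o\<^sub>L T \<in> B \<and> T o\<^sub>L a \<in> B}" by simp
qed (auto simp: zero_mem add_mem scaleR_mem compose_mem blinfun_compose_assoc[symmetric]
  bounded_bilinear.add_left[OF bounded_bilinear_blinfun_compose]
  bounded_bilinear.add_right[OF bounded_bilinear_blinfun_compose]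
  bounded_bilinear.scaleR_left[OF bounded_bilinear_blinfun_compose]
  bounded_bilinear.scaleR_right[OF bounded_bilinear_blinfun_compose], metis blinfun_compose_assoc)

end

section \<open>Real rank zero and sigma-closure\<close>

lemma tendsto_norm_zero_bound:
  fixes f :: "nat \<Rightarrow> 'a::real_normed_vector" and g :: "nat \<Rightarrow> real"
  assumes "g \<longlonglongrightarrow> 0" "\<And>n. norm (f n) \<le> g n"
  shows "(\<lambda>n. norm (f n)) \<longlonglongrightarrow> 0"
  by (rule tendsto_norm_zero, rule Lim_null_comparison[OF _ assms(1)]) (simp add: assms(2))

text \<open>\<open>corner_approx\<close> is real rank zero of every corner, with invertibility of
  the symmetric \<open>y\<close> stated as a lower norm bound, the form that
  \<open>sign_projection\<close> consumes. Units and unitizations are gone from here on.\<close>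

locale rr0_sigma_closed = op_algebra +
  assumes corner_approx: "is_proj p \<Longrightarrow> p \<in> B \<Longrightarrow> x \<in> corner p \<Longrightarrow> \<eta> > 0 \<Longrightarrow>
      \<exists>y\<in>corner p. \<exists>K>0. norm (x - y) \<le> \<eta> \<and> (\<forall>v. norm (p v) \<le> K * norm (y v))"
    and sigma: "(\<And>n. is_proj (P n) \<and> P n \<in> B \<and> P n \<noteq> 0) \<Longrightarrow> (\<And>n. P (Suc n) o\<^sub>L P n = P (Suc n)) \<Longrightarrow>
      \<exists>q\<in>B. is_proj q \<and> q \<noteq> 0 \<and> (\<forall>n::nat. q o\<^sub>L P n = q)"
begin

text \<open>
  If \<open>r\<close> is the spectral projection of an approximant of \<open>h - \<epsilon>/2\<close> for the positive half-line,
  then \<open>p' = p - R\<close> where \<open>R\<close> is the range projection of \<open>h r\<close>. Taking \<open>R\<close> rather than \<open>r\<close>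
  makes \<open>R\<close> factor through \<open>h\<close>, so that approximate null vectors of \<open>h\<close> survive exactly in the
  range of \<open>p'\<close>; this is what allows the step to be iterated.
\<close>

lemma spectral_step:
  assumes p: "is_proj p" "p \<in> B" and h: "h \<in> corner p" and \<epsilon>: "\<epsilon> > 0"
  obtains p' C where "is_proj p'" "p' \<in> B" "p' o\<^sub>L p = p'"
    "\<And>x. p' x = x \<Longrightarrow> h x \<bullet> x \<le> \<epsilon> * (norm x)\<^sup>2"
    "\<And>x. norm (p x - p' x) \<le> C * norm (h x)"
proof -
  note pd = is_projD[OF p(1)] and hd = cornerD[OF p(1) h]
  have hp: "h - (\<epsilon>/2) *\<^sub>R p \<in> corner p"
    using hd(1,2,5) p(2) pd(1)
    by (auto simp: corner_def diff_mem scaleR_mem blinfun.bilinear_simps pd(3) intro!: blinfun_eqI)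
  \<comment> \<open>For the \<open>r\<close> obtained next, the shift \<epsilon>/2 and the error
    \<epsilon>/4 give \<open>h\<close> at least \<epsilon>/4 on \<open>r\<close>, which makes
    \<open>r h^2 r\<close> invertible, and at most 3\<epsilon>/4 on \<open>p - r\<close>, which
    leaves \<epsilon>/4 for the cross term.\<close>
  obtain y K where y: "y \<in> corner p" "K > 0" "norm ((h - (\<epsilon>/2) *\<^sub>R p) - y) \<le> \<epsilon>/4"
    "\<And>v. norm (p v) \<le> K * norm (y v)"
    using corner_approx[OF p hp, of "\<epsilon>/4"] \<epsilon> by auto
  obtain r where r: "is_proj r" "r \<in> B" "\<And>x. p (r x) = r x" "\<And>x. r (p x) = r x"
    "\<And>x. y (r x) = r (y x)" "\<And>x. 0 \<le> y (r x) \<bullet> r x"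
    "\<And>x. y (p x - r x) \<bullet> (p x - r x) \<le> 0"
    using sign_projection[OF p y(1,2,4)] by blast
  note rd = is_projD[OF r(1)]
  define g where "g = (h - (\<epsilon>/2) *\<^sub>R p) - y"
  have h_eq: "h v = y v + (\<epsilon>/2) *\<^sub>R p v + g v" for v by (simp add: g_def blinfun.bilinear_simps)
  have gb: "g v \<bullet> w \<le> \<epsilon>/4 * norm v * norm w" "- (g v \<bullet> w) \<le> \<epsilon>/4 * norm v * norm w" for v w
  proof -
    have "\<bar>g v \<bullet> w\<bar> \<le> norm (g v) * norm w" by (rule Cauchy_Schwarz_ineq2)
    also have "\<dots> \<le> (norm g * norm v) * norm w" by (intro mult_right_mono norm_blinfun) simp
    also have "\<dots> \<le> (\<epsilon>/4 * norm v) * norm w" using y(3) by (intro mult_right_mono) (auto simp: g_def)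
    finally show "g v \<bullet> w \<le> \<epsilon>/4 * norm v * norm w" "- (g v \<bullet> w) \<le> \<epsilon>/4 * norm v * norm w" by auto
  qed
  define t where "t = r o\<^sub>L (h o\<^sub>L h) o\<^sub>L r"
  have t: "t \<in> corner r"
  proof -
    have "symm t" unfolding t_def using rd(1) hd(2) by (intro symm_conj symm_compose) auto
    moreover have "r o\<^sub>L t = t" by (intro blinfun_eqI) (simp add: t_def rd(3))
    ultimately show ?thesis using r(2) hd(1) by (auto simp: corner_def t_def compose_mem)
  qed
  have low: "(\<epsilon>/4)\<^sup>2 * (norm (r x))\<^sup>2 \<le> t x \<bullet> x" for x
  proof -
    have "\<epsilon>/4 * (norm (r x) * norm (r x)) \<le> y (r x) \<bullet> r x + \<epsilon>/2 * (norm (r x) * norm (r x)) + g (r x) \<bullet> r x"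
      using r(6)[of x] gb(2)[of "r x" "r x"] by simp
    also have "\<dots> = h (r x) \<bullet> r x"
      by (simp add: h_eq inner_add_left r(3) flip: power2_norm_eq_inner power2_eq_square)
    also have "\<dots> \<le> norm (h (r x)) * norm (r x)" by (rule norm_cauchy_schwarz)
    finally have "(\<epsilon>/4 * norm (r x)) * norm (r x) \<le> norm (h (r x)) * norm (r x)" by simp
    then have "\<epsilon>/4 * norm (r x) \<le> norm (h (r x))" by (cases "r x = 0") auto
    then have "(\<epsilon>/4 * norm (r x))\<^sup>2 \<le> (norm (h (r x)))\<^sup>2" using \<epsilon> by (intro power_mono) auto
    also have "\<dots> = t x \<bullet> x"
      using rd(4)[of "h (h (r x))" x] hd(7)[of "h (r x)" "r x"] by (simp add: t_def power2_norm_eq_inner)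
    finally show ?thesis by (simp only: power_mult_distrib)
  qed
  have "(\<epsilon>/4)\<^sup>2 > 0" using \<epsilon> by simp
  then obtain c where c: "c \<in> corner r" "t o\<^sub>L c = r" "c o\<^sub>L t = r"
    using corner_inverse[OF r(1,2) t _ low] by blast
  note cd = cornerD[OF r(1) c(1)]
  have tc: "r (h (h (c v))) = r v" for v
    using comp_apply_eq[OF c(2), of v] by (simp add: t_def cd(5))
  \<comment> \<open>For \<open>X = h r\<close> this is \<open>X (X* X)^{-1} X*\<close>, because
    \<open>c\<close> inverts \<open>r h^2 r\<close> in the corner of \<open>r\<close>.\<close>
  define R where "R = h o\<^sub>L c o\<^sub>L h"
  have Rx: "R v = h (c (h v))" for v by (simp add: R_def)
  have sR: "symm R" using hd(2) cd(2) by (simp add: R_def symm_conj)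
  have RR: "R (R v) = R v" for v
  proof -
    have "c (h (h (c w))) = c w" for w using cd(6)[of "h (h (c w))"] by (simp add: tc cd(6))
    then show ?thesis by (simp add: Rx)
  qed
  have pR: "p (R v) = R v" "R (p v) = R v" for v by (simp_all add: Rx hd(5,6))
  define p' where "p' = p - R"
  have p'x: "p' v = p v - R v" for v by (simp add: p'_def blinfun.diff_left)
  have p': "is_proj p'"
    using sR pd(1) by (intro is_projI) (auto simp: p'_def, simp add: blinfun.bilinear_simps pR RR pd(3))
  \<comment> \<open>A vector of \<open>p'\<close> is orthogonal to the range of \<open>h r\<close>,
    so \<open>r h x = 0\<close> and only the product of \<open>h x\<close> with
    \<open>x - r x\<close> survives. As \<open>y\<close> commutes with \<open>r\<close>, the cross
    term comes from \<open>g\<close> alone.\<close>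
  have "h x \<bullet> x \<le> \<epsilon> * (norm x)\<^sup>2" if x: "p' x = x" for x
  proof -
    have px: "p x = x" using x by (metis p'x pR(1) blinfun.diff_right pd(3))
    then have "R x = 0" using x by (simp add: p'x)
    moreover have "r (h (R x)) = r (h x)" by (simp add: Rx tc)
    ultimately have rh: "r (h x) = 0" by simp
    define w where "w = x - r x"
    have rw: "r w = 0" "p w = w" by (simp_all add: w_def blinfun.diff_right rd(3) px r(3))
    have "h x \<bullet> x = h x \<bullet> r x + h x \<bullet> w" by (simp add: w_def flip: inner_add_right)
    also have "h x \<bullet> r x = 0" using rd(4)[of "h x" x] rh by simp
    also have "h x \<bullet> w = h (r x) \<bullet> w + h w \<bullet> w" by (simp add: w_def blinfun.diff_right flip: inner_add_left)
    also have "h (r x) \<bullet> w = g (r x) \<bullet> w"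
    proof -
      have "r x \<bullet> w = 0" "y (r x) \<bullet> w = 0"
        using rd(4)[of x w] rd(4)[of "y x" w] rw r(5) by auto
      then show ?thesis by (simp add: h_eq inner_add_left r(3))
    qed
    also have "h w \<bullet> w \<le> \<epsilon>/2 * (norm w)\<^sup>2 + g w \<bullet> w"
      using r(7)[of x] by (simp add: h_eq inner_add_left rw power2_norm_eq_inner px flip: w_def)
    finally have "h x \<bullet> x \<le> \<epsilon>/2 * (norm w)\<^sup>2 + (g (r x) \<bullet> w + g w \<bullet> w)" by simp
    also have "\<dots> \<le> \<epsilon>/2 * (norm x)\<^sup>2 + (\<epsilon>/4 * (norm x)\<^sup>2 + \<epsilon>/4 * (norm x)\<^sup>2)"
    proof (intro add_mono)
      have nr: "norm (r x) \<le> norm x" by (rule norm_proj_le[OF r(1)])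
      have "(norm w)\<^sup>2 \<le> (norm x)\<^sup>2" using is_proj_pythagoras[OF r(1), of x] by (simp add: w_def)
      then have nw: "norm w \<le> norm x" by (rule power2_le_imp_le) simp
      show "\<epsilon>/2 * (norm w)\<^sup>2 \<le> \<epsilon>/2 * (norm x)\<^sup>2" using nw \<epsilon> by (intro mult_left_mono power_mono) auto
      have "\<epsilon>/4 * norm u * norm w \<le> \<epsilon>/4 * (norm x)\<^sup>2" if "norm u \<le> norm x" for u
        using mult_left_mono[OF mult_mono[OF that nw], of "\<epsilon>/4"] \<epsilon>
        by (simp add: power2_eq_square mult.assoc)
      then show "g (r x) \<bullet> w \<le> \<epsilon>/4 * (norm x)\<^sup>2" "g w \<bullet> w \<le> \<epsilon>/4 * (norm x)\<^sup>2"
        using gb(1) nr nw order_trans by blast+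
    qed
    finally show ?thesis by (simp add: algebra_simps)
  qed
  moreover have "norm (p x - p' x) \<le> norm (h o\<^sub>L c) * norm (h x)" for x
    using norm_blinfun[of "h o\<^sub>L c" "h x"] by (simp add: p'x Rx)
  moreover have "p' o\<^sub>L p = p'" by (intro blinfun_eqI) (simp add: p'x pd(3) pR)
  moreover have "p' \<in> B" using p(2) hd(1) cd(1) by (simp add: p'_def R_def diff_mem compose_mem)
  ultimately show thesis using that[of p'] p' by blast
qed

text \<open>The conclusion says \<open>k Q \<le> Q - Q P Q\<close>, the lower bound that
  \<open>corner_inverse\<close> asks for. Only common lower bounds inside \<open>B\<close> are
  excluded, because sigma-closure produces one there.\<close>

lemma angle_gap:
  assumes P: "is_proj P" "P \<in> B" and Q: "is_proj Q" "Q \<in> B"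
    and triv: "\<And>S. S \<in> B \<Longrightarrow> is_proj S \<Longrightarrow> S o\<^sub>L P = S \<Longrightarrow> S o\<^sub>L Q = S \<Longrightarrow> S = 0"
  obtains k where "k > 0" "\<And>x. k * (norm (Q x))\<^sup>2 \<le> (norm (Q x - P (Q x)))\<^sup>2"
proof (rule ccontr)
  assume "\<not> thesis"
  then have "\<exists>u. (norm (Q u - P (Q u)))\<^sup>2 < inverse (real (Suc n)) * (norm (Q u))\<^sup>2" for n
    using that[of "inverse (real (Suc n))"] by (meson linorder_not_less inverse_positive_iff_positive of_nat_0_less_iff zero_less_Suc)
  then obtain u where u: "\<And>n. (norm (Q (u n) - P (Q (u n))))\<^sup>2 < inverse (real (Suc n)) * (norm (Q (u n)))\<^sup>2"
    by metis
  define x where "x n = (1 / norm (Q (u n))) *\<^sub>R Q (u n)" for n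
  have u0: "Q (u n) \<noteq> 0" for n using u[of n] by auto
  have nx: "norm (x n) = 1" for n using u0 by (simp add: x_def)
  have Qx: "Q (x n) = x n" for n by (simp add: x_def blinfun.scaleR_right is_projD(3)[OF Q(1)])
  have "(norm (x n - P (x n)))\<^sup>2 \<le> inverse (real (Suc n))" for n
  proof -
    have "x n - P (x n) = (1 / norm (Q (u n))) *\<^sub>R (Q (u n) - P (Q (u n)))"
      by (simp add: x_def blinfun.scaleR_right scaleR_diff_right)
    then have "(norm (x n - P (x n)))\<^sup>2 = (norm (Q (u n) - P (Q (u n))))\<^sup>2 / (norm (Q (u n)))\<^sup>2"
      by (simp add: power_divide)
    then show ?thesis using u[of n] u0[of n] by (simp add: divide_le_eq less_imp_le)
  qed
  then have "(\<lambda>n. (norm (x n - P (x n)))\<^sup>2) \<longlonglongrightarrow> 0"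
    using Lim_null_comparison[OF _ LIMSEQ_inverse_real_of_nat, of "\<lambda>n. (norm (x n - P (x n)))\<^sup>2"] by simp
  then have "(\<lambda>n. sqrt ((norm (x n - P (x n)))\<^sup>2)) \<longlonglongrightarrow> sqrt 0" by (rule tendsto_real_sqrt)
  then have Px: "(\<lambda>n. norm (x n - P (x n))) \<longlonglongrightarrow> 0" by simp
  define \<Phi> where "\<Phi> p \<longleftrightarrow> is_proj p \<and> p \<in> B \<and> p o\<^sub>L Q = p \<and> (\<lambda>n. norm (x n - p (x n))) \<longlonglongrightarrow> 0" for p
  have step: "\<exists>p'. \<Phi> p' \<and> (p' o\<^sub>L p = p' \<and> (\<forall>v. p' v = v \<longrightarrow> (norm (v - P v))\<^sup>2 \<le> inverse (real (Suc n)) * (norm v)\<^sup>2))"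
    if "\<Phi> p" for p n
  proof -
    have p: "is_proj p" "p \<in> B" "p o\<^sub>L Q = p" and lim: "(\<lambda>n. norm (x n - p (x n))) \<longlonglongrightarrow> 0"
      using that by (auto simp: \<Phi>_def)
    note pd = is_projD[OF p(1)] and Pd = is_projD[OF P(1)]
    \<comment> \<open>This is \<open>p (1 - P) p\<close>. At a vector \<open>v\<close> of
      \<open>p\<close> its form is |v - P v|^2, so \<open>P\<close> is close to the identity where
      \<open>h\<close> is small.\<close>
    define h where "h = p - (p o\<^sub>L P o\<^sub>L p)"
    have hx: "h v = p v - p (P (p v))" for v by (simp add: h_def blinfun.diff_left)
    have h: "h \<in> corner p"
      using p(2) P(2) pd(1) Pd(1)
      by (auto simp: corner_def h_def diff_mem compose_mem symm_conj blinfun.bilinear_simps pd(3) intro!: blinfun_eqI)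
    obtain p' C where p': "is_proj p'" "p' \<in> B" "p' o\<^sub>L p = p'"
      "\<And>x. p' x = x \<Longrightarrow> h x \<bullet> x \<le> inverse (real (Suc n)) * (norm x)\<^sup>2"
      "\<And>x. norm (p x - p' x) \<le> C * norm (h x)"
      using spectral_step[OF p(1,2) h, of "inverse (real (Suc n))"] by auto
    have "norm (h (x k)) \<le> norm (x k - P (x k)) + norm (x k - p (x k))" for k
    proof -
      have "h (x k) = p ((x k - P (x k)) + P (x k - p (x k)))"
        by (simp add: hx blinfun.add_right blinfun.diff_right)
      then have "norm (h (x k)) \<le> norm ((x k - P (x k)) + P (x k - p (x k)))"
        using norm_proj_le[OF p(1)] by simp
      also have "\<dots> \<le> norm (x k - P (x k)) + norm (P (x k - p (x k)))" by (rule norm_triangle_ineq)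
      finally show ?thesis using norm_proj_le[OF P(1), of "x k - p (x k)"] by linarith
    qed
    moreover have "(\<lambda>k. norm (x k - P (x k)) + norm (x k - p (x k))) \<longlonglongrightarrow> 0"
      using tendsto_add[OF Px lim] by simp
    ultimately have "(\<lambda>k. norm (h (x k))) \<longlonglongrightarrow> 0"
      by (rule tendsto_norm_zero_bound[rotated])
    then have "(\<lambda>k. norm (x k - p (x k)) + C * norm (h (x k))) \<longlonglongrightarrow> 0"
      using tendsto_add[OF lim tendsto_mult_right_zero[of _ _ C]] by simp
    moreover have "norm (x k - p' (x k)) \<le> norm (x k - p (x k)) + C * norm (h (x k))" for k
      using norm_triangle_ineq[of "x k - p (x k)" "p (x k) - p' (x k)"] p'(5)[of "x k"] by simp
    ultimately have "(\<lambda>k. norm (x k - p' (x k))) \<longlonglongrightarrow> 0"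
      by (rule tendsto_norm_zero_bound)
    moreover have "p' o\<^sub>L Q = p'" using p'(3) p(3) by (metis blinfun_compose_assoc)
    moreover have "(norm (v - P v))\<^sup>2 \<le> inverse (real (Suc n)) * (norm v)\<^sup>2" if v: "p' v = v" for v
    proof -
      have "p o\<^sub>L p' = p'" using symm_swap[OF is_projD(1)[OF p'(1)] pd(1) is_projD(1)[OF p'(1)] p'(3)] .
      then have pv: "p v = v" using v by (metis blinfun_apply_blinfun_compose)
      have "h v \<bullet> v = (norm v)\<^sup>2 - (norm (P v))\<^sup>2"
        using pd(4)[of "P v" v] Pd(6)[of v] by (simp add: hx pv inner_diff_left power2_norm_eq_inner)
      then show ?thesis using p'(4)[OF v] is_proj_pythagoras[OF P(1), of v] by simp
    qed
    ultimately show ?thesis using p'(1-3) by (auto simp: \<Phi>_def)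
  qed
  have "\<Phi> Q" using Q is_projD(2)[OF Q(1)] by (simp add: \<Phi>_def Qx)
  then obtain f where f: "\<And>n. \<Phi> (f n)" "\<And>n. f (Suc n) o\<^sub>L f n = f (Suc n)"
    "\<And>n v. f (Suc n) v = v \<Longrightarrow> (norm (v - P v))\<^sup>2 \<le> inverse (real (Suc n)) * (norm v)\<^sup>2"
    using dependent_nat_choice[of "\<lambda>_. \<Phi>" "\<lambda>n p p'. p' o\<^sub>L p = p' \<and> (\<forall>v. p' v = v \<longrightarrow> (norm (v - P v))\<^sup>2 \<le> inverse (real (Suc n)) * (norm v)\<^sup>2)"]
      step by metis
  have "f n \<noteq> 0" for n
  proof
    assume "f n = 0"
    then have "(\<lambda>n. norm (x n)) \<longlonglongrightarrow> 0" using f(1)[of n] by (simp add: \<Phi>_def)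
    then show False by (simp add: nx LIMSEQ_const_iff)
  qed
  then obtain q where q: "q \<in> B" "is_proj q" "q \<noteq> 0" "\<And>n. q o\<^sub>L f n = q"
    using sigma[of f] f(1,2) by (auto simp: \<Phi>_def)
  note qd = is_projD[OF q(2)]
  have fq: "f n (q v) = q v" for n v
    using symm_swap[OF qd(1) _ qd(1) q(4)[of n]] f(1)[of n] is_projD(1)
    by (metis \<Phi>_def blinfun_apply_blinfun_compose)
  have "P (q v) = q v" for v
  proof -
    have "(\<lambda>n. inverse (real (Suc n)) * (norm (q v))\<^sup>2) \<longlonglongrightarrow> 0"
      using tendsto_mult_left_zero[OF LIMSEQ_inverse_real_of_nat] .
    then have "(norm (q v - P (q v)))\<^sup>2 \<le> 0"
      using f(3)[OF fq] by (intro tendsto_lowerbound) auto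
    then show ?thesis by simp
  qed
  then have "P o\<^sub>L q = q" by (simp add: blinfun_eqI)
  then have "q o\<^sub>L P = q" using symm_swap is_projD(1) P(1) qd(1) by blast
  moreover have "q o\<^sub>L Q = q"
    using q(4)[of 0] f(1)[of 0] by (metis \<Phi>_def blinfun_compose_assoc)
  ultimately show False using triv q by blast
qed

text \<open>The last clause admits every operator \<open>S\<close>: as \<open>c = c Q\<close>, the
  product \<open>J S\<close> depends only on \<open>P S\<close> and \<open>Q S\<close>. This is used
  later for \<open>id_blinfun - M\<close>, which may lie outside \<open>B\<close>.\<close>

lemma join_of_disjoint:
  assumes P: "is_proj P" "P \<in> B" and Q: "is_proj Q" "Q \<in> B"
    and triv: "\<And>S. S \<in> B \<Longrightarrow> is_proj S \<Longrightarrow> S o\<^sub>L P = S \<Longrightarrow> S o\<^sub>L Q = S \<Longrightarrow> S = 0"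
  obtains J where "is_proj J" "J \<in> B" "P o\<^sub>L J = P" "Q o\<^sub>L J = Q"
    "\<And>S. P o\<^sub>L S = P \<Longrightarrow> Q o\<^sub>L S = Q \<Longrightarrow> J o\<^sub>L S = J"
proof -
  note Pd = is_projD[OF P(1)] and Qd = is_projD[OF Q(1)]
  obtain k where k: "k > 0" "\<And>x. k * (norm (Q x))\<^sup>2 \<le> (norm (Q x - P (Q x)))\<^sup>2"
    using angle_gap[OF P Q triv] by blast
  define t where "t = Q - (Q o\<^sub>L P o\<^sub>L Q)"
  have tx: "t v = Q v - Q (P (Q v))" for v by (simp add: t_def blinfun.diff_left)
  have t: "t \<in> corner Q"
    using P(2) Q(2) Pd(1) Qd(1)
    by (auto simp: corner_def t_def diff_mem compose_mem symm_conj blinfun.bilinear_simps Qd(3) intro!: blinfun_eqI)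
  have "k * (norm (Q x))\<^sup>2 \<le> t x \<bullet> x" for x
  proof -
    have "t x \<bullet> x = (norm (Q x))\<^sup>2 - (norm (P (Q x)))\<^sup>2"
      using Qd(4)[of "P (Q x)" x] Qd(6)[of x] Pd(6)[of "Q x"] by (simp add: tx inner_diff_left)
    then show ?thesis using k(2)[of x] is_proj_pythagoras[OF P(1), of "Q x"] by simp
  qed
  then obtain c where c: "c \<in> corner Q" "t o\<^sub>L c = Q" "c o\<^sub>L t = Q"
    using corner_inverse[OF Q t k(1)] by blast
  note cd = cornerD[OF Q(1) c(1)]
  have tc: "c v - Q (P (c v)) = Q v" for v
    using comp_apply_eq[OF c(2), of v] by (simp add: tx cd(5))
  \<comment> \<open>\<open>F\<close> is the range projection of \<open>(1 - P) Q\<close>.\<close>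
  define F where "F = (id_blinfun - P) o\<^sub>L c o\<^sub>L (id_blinfun - P)"
  have Fx: "F v = c (v - P v) - P (c (v - P v))" for v by (simp add: F_def blinfun.diff_left)
  have sF: "symm F" unfolding F_def using Pd(1) cd(2) by (intro symm_conj) auto
  have PF: "P (F v) = 0" "F (P v) = 0" for v by (simp_all add: Fx blinfun.diff_right Pd(3))
  have QF: "Q (F v) = Q (v - P v)" for v
    using tc[of "v - P v"] by (simp add: Fx blinfun.diff_right cd(5))
  have FF: "F (F v) = F v" for v
  proof -
    have "F (F v) = c (F v) - P (c (F v))" by (simp add: Fx[of "F v"] PF)
    also have "c (F v) = c (Q (F v))" by (simp add: cd(6))
    also have "\<dots> = c (v - P v)" by (simp only: QF cd(6))
    finally show ?thesis by (simp add: Fx)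
  qed
  have FB: "F \<in> B"
  proof -
    \<comment> \<open>The identity need not be in \<open>B\<close>, so membership is read off the
      expanded product.\<close>
    have "F = c - (P o\<^sub>L c) - ((c o\<^sub>L P) - (P o\<^sub>L c o\<^sub>L P))"
      by (intro blinfun_eqI) (simp add: Fx blinfun.bilinear_simps)
    then show ?thesis using P(2) cd(1) by (simp add: diff_mem compose_mem)
  qed
  define J where "J = P + F"
  have Jx: "J v = P v + F v" for v by (simp add: J_def blinfun.add_left)
  show thesis
  proof (rule that[of J])
    show "is_proj J"
      using Pd(1) sF by (intro is_projI) (auto simp: J_def, simp add: blinfun.add_left blinfun.add_right PF FF Pd(3))
    show "J \<in> B" using P(2) FB by (simp add: J_def add_mem)
    show "P o\<^sub>L J = P" by (intro blinfun_eqI) (simp add: Jx blinfun.add_right PF Pd(3))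
    show "Q o\<^sub>L J = Q" by (intro blinfun_eqI) (simp add: Jx blinfun.add_right QF blinfun.diff_right)
    show "J o\<^sub>L S = J" if S: "P o\<^sub>L S = P" "Q o\<^sub>L S = Q" for S
    proof (rule blinfun_eqI)
      fix v
      have PS: "P (S v) = P v" using S(1) by (rule comp_apply_eq)
      have "c (S v) = c (Q (S v))" by (simp only: cd(6))
      also have "\<dots> = c v" by (simp only: comp_apply_eq[OF S(2)] cd(6))
      finally show "(J o\<^sub>L S) v = J v" by (simp add: Jx Fx PS blinfun.diff_right)
    qed
  qed
qed

end

section \<open>Meets and joins\<close>

lemma is_proj_diff:
  assumes "is_proj P" "is_proj M" "M o\<^sub>L P = M"
  shows "is_proj (P - M)"
proof (rule is_projI)
  note Pd = is_projD[OF assms(1)] and Md = is_projD[OF assms(2)]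
  show "symm (P - M)" using Pd Md by simp
  have "M (P x) = M x" "P (M x) = M x" for x
    using assms(3) symm_swap[OF Md(1) Pd(1) Md(1) assms(3)] by (simp_all add: comp_apply_eq)
  then show "(P - M) ((P - M) x) = (P - M) x" for x
    by (simp add: blinfun.bilinear_simps Pd(3) Md(3))
qed

lemma is_proj_id: "is_proj id_blinfun"
  by (simp add: is_projI)

lemma norm_proj_eqD:
  assumes "is_proj P" "norm x \<le> norm (P x)"
  shows "P x = x"
proof -
  have "(norm x)\<^sup>2 \<le> (norm (P x))\<^sup>2" using assms(2) by (intro power_mono) auto
  then have "(norm (x - P x))\<^sup>2 \<le> 0" using is_proj_pythagoras[OF assms(1), of x] by simp
  then show ?thesis by simp
qed

text \<open>The meet is the strong limit of \<open>(P Q P) ^ n\<close>.\<close>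

lemma meet_exists:
  fixes P Q :: "'a::{real_inner,complete_space} \<Rightarrow>\<^sub>L 'a"
  assumes P: "is_proj P" and Q: "is_proj Q"
  obtains R where "is_proj R" "R o\<^sub>L P = R" "R o\<^sub>L Q = R"
    "\<And>S :: 'a \<Rightarrow>\<^sub>L 'a. S o\<^sub>L P = S \<Longrightarrow> S o\<^sub>L Q = S \<Longrightarrow> S o\<^sub>L R = S"
    "\<And>(u :: 'a \<Rightarrow> 'a) x. bounded_linear u \<Longrightarrow> (\<And>x. P (u x) = u (P x)) \<Longrightarrow> (\<And>x. Q (u x) = u (Q x)) \<Longrightarrow> R (u x) = u (R x)"
proof -
  note Pd = is_projD[OF P] and Qd = is_projD[OF Q]
  define T where "T = P o\<^sub>L Q o\<^sub>L P"
  have T: "T v = P (Q (P v))" for v by (simp add: T_def)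
  have sT: "T v \<bullet> w = v \<bullet> T w" for v w
    using symm_conj[OF Pd(1) Qd(1)] by (simp add: T_def symm_def)
  define a where "a n = (blinfun_apply T ^^ n)" for n
  have a0: "a 0 v = v" and aS: "a (Suc n) v = T (a n v)" for n v by (simp_all add: a_def)
  have aS': "a (Suc n) v = a n (T v)" for n v by (simp add: a_def funpow_swap1)
  have sa: "a n v \<bullet> w = v \<bullet> a n w" for n v w
    by (induction n arbitrary: v w) (simp_all only: a0 aS sT, metis aS aS')
  have aadd: "a (m + n) v = a m (a n v)" for m n v by (simp add: a_def funpow_add)
  have alin: "a n (v + w) = a n v + a n w" "a n (r *\<^sub>R v) = r *\<^sub>R a n v" for n v w r
    by (induction n) (simp_all add: a0 aS blinfun.bilinear_simps)
  have nT: "norm (T v) \<le> norm v" for v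
    unfolding T using norm_proj_le[OF P] norm_proj_le[OF Q] order_trans by metis
  have na: "norm (a n v) \<le> norm v" for n v
    by (induction n) (auto simp: a0 aS intro: order_trans[OF nT])
  \<comment> \<open>The values at 2m, 2m+1, 2m+2 are the squared norms of \<open>a m x\<close>,
    \<open>Q P (a m x)\<close> and \<open>P Q P (a m x)\<close>. Projections do not increase norms,
    so \<open>t x\<close> decreases; its convergence makes \<open>a n x\<close> Cauchy.\<close>
  define t where "t x n = a n x \<bullet> x" for x n
  have tadd: "a m x \<bullet> a n x = t x (n + m)" for x m n
    by (simp add: t_def aadd sa[of n])
  have even: "t x (2 * m) = (norm (a m x))\<^sup>2" for x m
    using tadd[of m x m] by (simp add: power2_norm_eq_inner mult_2)
  have odd: "t x (Suc (2 * m)) = (norm (Q (P (a m x))))\<^sup>2" for x m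
  proof -
    have "t x (Suc (2 * m)) = T (a m x) \<bullet> a m x"
      using tadd[of "Suc m" x m] by (simp add: aS mult_2)
    also have "\<dots> = Q (P (a m x)) \<bullet> P (a m x)" by (simp add: T Pd(4))
    finally show ?thesis by (simp add: Qd(6))
  qed
  have dec: "t x (Suc n) \<le> t x n" for x n
  proof (cases "even n")
    case True
    then obtain m where n: "n = 2 * m" by blast
    have "norm (Q (P (a m x))) \<le> norm (a m x)"
      using norm_proj_le[OF P] norm_proj_le[OF Q] order_trans by metis
    then show ?thesis unfolding n even odd by (intro power_mono) auto
  next
    case False
    then obtain m where n: "n = Suc (2 * m)" by (metis oddE Suc_eq_plus1)
    have "norm (P (Q (P (a m x)))) \<le> norm (Q (P (a m x)))" by (rule norm_proj_le[OF P])
    then have "t x (2 * Suc m) \<le> t x n" unfolding n even odd aS T by (intro power_mono) auto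
    then show ?thesis by (simp add: n)
  qed
  have conv: "convergent (\<lambda>n. a n x)" for x
  proof -
    have "decseq (t x)" using dec by (simp add: decseq_SucI)
    moreover have "0 \<le> t x n" for n
    proof (cases "even n")
      case True then show ?thesis by (metis even evenE zero_le_power2)
    next
      case False then show ?thesis by (metis odd oddE Suc_eq_plus1 zero_le_power2)
    qed
    ultimately obtain L where "t x \<longlonglongrightarrow> L" using decseq_convergent[of "t x" 0] by blast
    then have lim: "(\<lambda>n. t x n - L) \<longlonglongrightarrow> 0" by (simp add: LIM_zero)
    have "Cauchy (\<lambda>n. a n x)"
    proof (rule CauchyI)
      fix e :: real assume e: "0 < e"
      \<comment> \<open>Three values of \<open>t x\<close> enter below with weights 1, -2, 1, whence
        the quarter.\<close>
      then obtain N where N: "\<And>n. n \<ge> N \<Longrightarrow> \<bar>t x n - L\<bar> < e\<^sup>2 / 4"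
        using LIMSEQ_D[OF lim, of "e\<^sup>2 / 4"] by auto
      have "norm (a m x - a n x) < e" if "m \<ge> N" "n \<ge> N" for m n
      proof (rule power2_less_imp_less)
        have "(norm (a m x - a n x))\<^sup>2 = t x (m + m) - 2 * t x (m + n) + t x (n + n)"
          by (simp add: power2_norm_eq_inner inner_diff_left inner_diff_right tadd add.commute)
        also have "\<dots> < e\<^sup>2"
          using N[of "m + m"] N[of "m + n"] N[of "n + n"] that by linarith
        finally show "(norm (a m x - a n x))\<^sup>2 < e\<^sup>2" .
      qed (use e in simp)
      then show "\<exists>M. \<forall>m\<ge>M. \<forall>n\<ge>M. norm (a m x - a n x) < e" by blast
    qed
    then show ?thesis by (simp add: Cauchy_convergent_iff)
  qed
  then obtain r where r: "\<And>x. (\<lambda>n. a n x) \<longlonglongrightarrow> r x"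
    unfolding convergent_def by metis
  have "bounded_linear r"
  proof (rule bounded_linear_intro)
    show "r (x + y) = r x + r y" for x y
      using LIMSEQ_unique[OF r[of "x + y"]] tendsto_add[OF r r] by (simp add: alin)
    show "r (c *\<^sub>R x) = c *\<^sub>R r x" for c x
      using LIMSEQ_unique[OF r[of "c *\<^sub>R x"]] tendsto_scaleR[OF tendsto_const r] by (simp add: alin)
    show "norm (r x) \<le> norm x * 1" for x
      using tendsto_upperbound[OF tendsto_norm[OF r[of x]], of "norm x"] na by simp
  qed
  then have R: "blinfun_apply (Blinfun r) = r" by (rule bounded_linear_Blinfun_apply)
  have lim_u: "(\<lambda>n. u (a n x)) \<longlonglongrightarrow> u (r x)" if "bounded_linear u" for u :: "'a \<Rightarrow> 'a" and x
    by (rule bounded_linear.tendsto[OF that r])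
  have Tr: "T (r x) = r x" for x
    using LIMSEQ_unique[OF lim_u[OF blinfun.bounded_linear_right[of T], of x]] LIMSEQ_Suc[OF r[of x]]
    by (simp add: aS)
  \<comment> \<open>\<open>r x\<close> is fixed by \<open>P Q P\<close>, so no factor can shorten
    it, and a projection that preserves the norm of a vector fixes the vector.\<close>
  have Pr: "P (r x) = r x" and Qr: "Q (r x) = r x" for x
  proof -
    have 1: "norm (r x) \<le> norm (Q (P (r x)))" using norm_proj_le[OF P, of "Q (P (r x))"] Tr[of x] by (simp add: T)
    then have "norm (r x) \<le> norm (P (r x))" using norm_proj_le[OF Q] order_trans by blast
    then show "P (r x) = r x" by (rule norm_proj_eqD[OF P])
    with 1 have "norm (r x) \<le> norm (Q (r x))" by simp
    then show "Q (r x) = r x" by (rule norm_proj_eqD[OF Q])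
  qed
  have sr: "symm (Blinfun r)" unfolding symm_def R
  proof (intro allI)
    fix x y
    have "(\<lambda>n. a n x \<bullet> y) \<longlonglongrightarrow> r x \<bullet> y" by (intro tendsto_intros r)
    moreover have "(\<lambda>n. a n x \<bullet> y) \<longlonglongrightarrow> x \<bullet> r y" unfolding sa by (intro tendsto_intros r)
    ultimately show "r x \<bullet> y = x \<bullet> r y" by (rule LIMSEQ_unique)
  qed
  have rr: "r (r x) = r x" for x
  proof -
    have "a n (r x) = r x" for n by (induction n) (simp_all add: a0 aS Tr)
    then show ?thesis using LIMSEQ_unique[OF r[of "r x"], of "r x"] by simp
  qed
  show thesis
  proof (rule that[of "Blinfun r"])
    show "is_proj (Blinfun r)" using sr by (rule is_projI) (simp add: R rr)
    show "Blinfun r o\<^sub>L P = Blinfun r"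
      by (rule symm_swap[OF Pd(1) sr sr]) (simp add: blinfun_eqI R Pr)
    show "Blinfun r o\<^sub>L Q = Blinfun r"
      by (rule symm_swap[OF Qd(1) sr sr]) (simp add: blinfun_eqI R Qr)
    show "S o\<^sub>L Blinfun r = S" if "S o\<^sub>L P = S" "S o\<^sub>L Q = S" for S :: "'a \<Rightarrow>\<^sub>L 'a"
    proof (rule blinfun_eqI)
      fix x
      have "S (T v) = S v" for v using that by (metis T blinfun_apply_blinfun_compose)
      then have "S (a n x) = S x" for n by (induction n) (simp_all add: a0 aS)
      then show "(S o\<^sub>L Blinfun r) x = S x"
        using LIMSEQ_unique[OF lim_u[OF blinfun.bounded_linear_right[of S], of x], of "S x"] by (simp add: R)
    qed
    \<comment> \<open>With \<open>u\<close> a scalar multiplication this gives linearity of the meet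
      over the scalar field, which the real construction does not show by itself.\<close>
    show "Blinfun r (u x) = u (Blinfun r x)"
      if u: "bounded_linear u" "\<And>x. P (u x) = u (P x)" "\<And>x. Q (u x) = u (Q x)" for u x
    proof -
      have "a n (u x) = u (a n x)" for n by (induction n) (simp_all add: a0 aS T u(2,3))
      then show ?thesis
        using LIMSEQ_unique[OF r[of "u x"]] lim_u[OF u(1), of x] by (simp add: R)
    qed
  qed
qed

text \<open>\<open>D\<close> is a parameter to keep the scalar field out of the lattice argument,
  which only asks that \<open>D\<close> consist of projections and contain those of
  \<open>B\<close>.\<close>

definition is_glb where
  "is_glb D P Q M \<longleftrightarrow> M \<in> D \<and> M o\<^sub>L P = M \<and> M o\<^sub>L Q = M \<and>
     (\<forall>S\<in>D. S o\<^sub>L P = S \<and> S o\<^sub>L Q = S \<longrightarrow> S o\<^sub>L M = S)"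

definition is_lub where
  "is_lub D P Q J \<longleftrightarrow> J \<in> D \<and> P o\<^sub>L J = P \<and> Q o\<^sub>L J = Q \<and>
     (\<forall>S\<in>D. P o\<^sub>L S = P \<and> Q o\<^sub>L S = Q \<longrightarrow> J o\<^sub>L S = J)"

lemma proj_le_swap:
  assumes "is_proj P" "is_proj Q" "P o\<^sub>L Q = P"
  shows "Q o\<^sub>L P = P"
  using symm_swap is_projD(1) assms by blast

lemma proj_le_antisym:
  assumes "is_proj P" "is_proj Q" "P o\<^sub>L Q = P" "Q o\<^sub>L P = Q"
  shows "P = Q"
  using proj_le_swap[OF assms(1,2,3)] assms(4) by simp

context rr0_sigma_closed begin

lemma join_mem_of_meet_mem:
  assumes D: "\<And>S. S \<in> D \<Longrightarrow> is_proj S" "\<And>S. is_proj S \<Longrightarrow> S \<in> B \<Longrightarrow> S \<in> D"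
    and P: "is_proj P" "P \<in> B" and Q: "is_proj Q" "Q \<in> B"
    and M: "is_glb D P Q M" "M \<in> B"
  obtains J where "J \<in> B" "is_lub D P Q J"
proof -
  have pM: "is_proj M" and MP: "M o\<^sub>L P = M" and MQ: "M o\<^sub>L Q = M"
    and great: "\<And>S. S \<in> D \<Longrightarrow> S o\<^sub>L P = S \<Longrightarrow> S o\<^sub>L Q = S \<Longrightarrow> S o\<^sub>L M = S"
    using M(1) D(1) by (auto simp: is_glb_def)
  have MM: "M o\<^sub>L M = M" and PP: "P o\<^sub>L P = P" and QQ: "Q o\<^sub>L Q = Q"
    using is_projD(2) pM P Q by auto
  have PM: "P o\<^sub>L M = M" and QM: "Q o\<^sub>L M = M"
    using proj_le_swap pM P(1) Q(1) MP MQ by blast+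
  \<comment> \<open>\<open>S\<close> is below \<open>P\<close> and \<open>Q\<close>, hence below
    \<open>M\<close>; but being below \<open>P - M\<close> it is orthogonal to
    \<open>M\<close>.\<close>
  have triv: "S = 0" if S: "S \<in> B" "is_proj S" "S o\<^sub>L (P - M) = S" "S o\<^sub>L (Q - M) = S" for S
  proof -
    have "(P - M) o\<^sub>L P = P - M" "(Q - M) o\<^sub>L Q = Q - M"
      by (simp_all add: blinfun_compose_distribs PP QQ MP MQ)
    then have SP: "S o\<^sub>L P = S" "S o\<^sub>L Q = S" using S(3,4) by (metis blinfun_compose_assoc)+
    then have "S o\<^sub>L M = S" using great D(2) S(1,2) by blast
    then have "S o\<^sub>L (P - M) = 0" using SP by (simp add: blinfun_compose_distribs)
    then show ?thesis using S(3) by simp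
  qed
  obtain J where J: "is_proj J" "J \<in> B" "(P - M) o\<^sub>L J = P - M" "(Q - M) o\<^sub>L J = Q - M"
    "\<And>S. (P - M) o\<^sub>L S = P - M \<Longrightarrow> (Q - M) o\<^sub>L S = Q - M \<Longrightarrow> J o\<^sub>L S = J"
    using join_of_disjoint[OF is_proj_diff[OF P(1) pM MP] diff_mem[OF P(2) M(2)]
        is_proj_diff[OF Q(1) pM MQ] diff_mem[OF Q(2) M(2)] triv] by blast
  \<comment> \<open>\<open>id_blinfun - M\<close> is above \<open>P - M\<close> and
    \<open>Q - M\<close>. So \<open>J\<close> is orthogonal to \<open>M\<close>, and the join of
    \<open>P\<close> and \<open>Q\<close> is the orthogonal sum \<open>M + J\<close>.\<close>
  have "J o\<^sub>L (id_blinfun - M) = J"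
    by (rule J(5)) (simp_all add: blinfun_compose_distribs PM QM MM blinfun_compose_id)
  then have JM: "J o\<^sub>L M = 0"
    by (simp add: blinfun_compose_distribs blinfun_compose_id)
  then have MJ: "M o\<^sub>L J = 0" using symm_swap is_projD(1) J(1) pM symm_simps(1) by blast
  have "is_proj (M + J)"
    using is_projD(1)[OF pM] is_projD(1)[OF J(1)] is_projD(2)[OF J(1)]
    by (simp add: is_proj_def blinfun_compose_distribs MM JM MJ)
  then have "M + J \<in> D" using D(2) M(2) J(2) add_mem by blast
  moreover have "P o\<^sub>L (M + J) = P" "Q o\<^sub>L (M + J) = Q"
    using J(3,4) by (simp_all add: blinfun_compose_distribs PM QM MJ)
  moreover have "(M + J) o\<^sub>L S = M + J" if S: "P o\<^sub>L S = P" "Q o\<^sub>L S = Q" for S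
  proof -
    have "M o\<^sub>L S = M" using MP S(1) by (metis blinfun_compose_assoc)
    then show ?thesis using S J(5)[of S] by (simp add: blinfun_compose_distribs)
  qed
  ultimately show thesis using that[of "M + J"] M(2) J(2) add_mem by (auto simp: is_lub_def)
qed

text \<open>De Morgan relative to \<open>J\<close>, as the identity may be missing from
  \<open>B\<close>: the meet is \<open>J - K\<close> for the join \<open>K\<close> of
  \<open>J - P\<close> and \<open>J - Q\<close>.\<close>

lemma meet_mem_of_join_mem:
  assumes D: "\<And>S. S \<in> D \<Longrightarrow> is_proj S" "\<And>S. is_proj S \<Longrightarrow> S \<in> B \<Longrightarrow> S \<in> D"
    and P: "is_proj P" "P \<in> B" and Q: "is_proj Q" "Q \<in> B"
    and J: "is_lub D P Q J" "J \<in> B"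
  obtains M where "M \<in> B" "is_glb D P Q M"
proof -
  have pJ: "is_proj J" and PJ: "P o\<^sub>L J = P" and QJ: "Q o\<^sub>L J = Q"
    and least: "\<And>S. S \<in> D \<Longrightarrow> P o\<^sub>L S = P \<Longrightarrow> Q o\<^sub>L S = Q \<Longrightarrow> J o\<^sub>L S = J"
    using J(1) D(1) by (auto simp: is_lub_def)
  have JJ: "J o\<^sub>L J = J" and PP: "P o\<^sub>L P = P" and QQ: "Q o\<^sub>L Q = Q"
    using is_projD(2) pJ P Q by auto
  have JP: "J o\<^sub>L P = P" and JQ: "J o\<^sub>L Q = Q"
    using proj_le_swap pJ P(1) Q(1) PJ QJ by blast+
  note pJP = is_proj_diff[OF pJ P(1) PJ] and pJQ = is_proj_diff[OF pJ Q(1) QJ]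
  have triv: "S = 0" if S: "S \<in> B" "is_proj S" "S o\<^sub>L (J - P) = S" "S o\<^sub>L (J - Q) = S" for S
  proof -
    have "(J - P) o\<^sub>L J = J - P" by (simp add: blinfun_compose_distribs JJ PJ)
    then have SJ: "S o\<^sub>L J = S" using S(3) by (metis blinfun_compose_assoc)
    have "S o\<^sub>L P = 0" "S o\<^sub>L Q = 0"
      using S(3,4) SJ by (simp_all add: blinfun_compose_distribs)
    then have "P o\<^sub>L S = 0" "Q o\<^sub>L S = 0"
      using symm_swap is_projD(1) S(2) P(1) Q(1) symm_simps(1) by blast+
    \<comment> \<open>\<open>S\<close> is orthogonal to \<open>P\<close> and \<open>Q\<close>, so
      \<open>J - S\<close> still bounds both from above. Minimality of \<open>J\<close> forces
      \<open>J S = 0\<close>, although \<open>S\<close> is below \<open>J\<close>.\<close>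
    then have "J o\<^sub>L (J - S) = J"
      using is_proj_diff[OF pJ S(2) SJ] diff_mem[OF J(2) S(1)]
      by (intro least D(2)) (simp_all add: blinfun_compose_distribs PJ QJ)
    then have "J o\<^sub>L S = 0" by (simp add: blinfun_compose_distribs JJ)
    then show ?thesis using proj_le_swap[OF S(2) pJ SJ] by simp
  qed
  obtain K where K: "is_proj K" "K \<in> B" "(J - P) o\<^sub>L K = J - P" "(J - Q) o\<^sub>L K = J - Q"
    "\<And>S. (J - P) o\<^sub>L S = J - P \<Longrightarrow> (J - Q) o\<^sub>L S = J - Q \<Longrightarrow> K o\<^sub>L S = K"
    using join_of_disjoint[OF pJP diff_mem[OF J(2) P(2)] pJQ diff_mem[OF J(2) Q(2)] triv] by blast
  have KJ: "K o\<^sub>L J = K"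
    by (rule K(5)) (simp_all add: blinfun_compose_distribs JJ PJ QJ)
  have "K o\<^sub>L (J - P) = J - P" "K o\<^sub>L (J - Q) = J - Q"
    using proj_le_swap K(1,3,4) pJP pJQ by blast+
  then have KP: "K o\<^sub>L P = K - (J - P)" and KQ: "K o\<^sub>L Q = K - (J - Q)"
    by (simp_all add: blinfun_compose_distribs KJ algebra_simps)
  have pM: "is_proj (J - K)" by (rule is_proj_diff[OF pJ K(1) KJ])
  moreover have "(J - K) o\<^sub>L P = J - K" "(J - K) o\<^sub>L Q = J - K"
    by (simp_all add: blinfun_compose_distribs JP JQ KP KQ)
  moreover have "S o\<^sub>L (J - K) = S" if S: "S \<in> D" "S o\<^sub>L P = S" "S o\<^sub>L Q = S" for S
  proof -
    have SJ: "S o\<^sub>L J = S" using S(2) PJ by (metis blinfun_compose_assoc)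
    have pS: "is_proj S" using D(1) S(1) .
    have JS: "J o\<^sub>L S = S" and PS: "P o\<^sub>L S = S" and QS: "Q o\<^sub>L S = S"
      using proj_le_swap pS pJ P(1) Q(1) SJ S by blast+
    have "K o\<^sub>L (J - S) = K"
      by (rule K(5)) (simp_all add: blinfun_compose_distribs JJ PJ QJ JS PS QS)
    then have "K o\<^sub>L S = 0" by (simp add: blinfun_compose_distribs KJ)
    then have "S o\<^sub>L K = 0" using symm_swap is_projD(1) pS K(1) symm_simps(1) by blast
    then show ?thesis by (simp add: blinfun_compose_distribs SJ)
  qed
  ultimately show thesis
    using that[of "J - K"] D(2) diff_mem[OF J(2) K(2)] by (auto simp: is_glb_def)
qed

end

section \<open>Reduction to the real inner product\<close>

context hilbert_space begin

lemma ip_add_right: "ip x (y + z) = ip x y + ip x z"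
  by (metis ip_add_left ip_commute rc_cnj_add)

text \<open>Polarisation; the sum is twice the real part of \<open>ip x y\<close>, written without a
  real-part map on the scalars.\<close>

lemma of_real_inner: "of_real (2 * (x \<bullet> y)) = ip x y + ip y x"
proof -
  have "ip (x + y) (x + y) = ip x x + ip y y + (ip x y + ip y x)"
    by (simp add: ip_add_left ip_add_right)
  then have "ip x y + ip y x = of_real ((norm (x + y))\<^sup>2 - (norm x)\<^sup>2 - (norm y)\<^sup>2)"
    by (simp add: ip_self)
  also have "(norm (x + y))\<^sup>2 - (norm x)\<^sup>2 - (norm y)\<^sup>2 = 2 * (x \<bullet> y)"
    by (simp add: power2_norm_eq_inner inner_add_left inner_add_right inner_commute)
  finally show ?thesis by simp
qed

lemma inner_eq_of_ip_eq:
  assumes "ip x y = ip u v"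
  shows "x \<bullet> y = u \<bullet> v"
proof -
  have "ip y x = ip v u" using assms ip_commute[of y x] ip_commute[of v u] by simp
  then have "of_real (2 * (x \<bullet> y)) = (of_real (2 * (u \<bullet> v)) :: 'k)"
    using assms by (simp only: of_real_inner)
  then show ?thesis by (simp only: of_real_eq_iff)
qed

lemma self_adjoint_imp_symm: "self_adjoint ip T \<Longrightarrow> symm T"
  unfolding self_adjoint_def is_adjoint_def symm_def using inner_eq_of_ip_eq by blast

text \<open>Symmetry only equates real parts. Replacing \<open>x\<close> by \<open>scl c x\<close>
  shows that \<open>c * z\<close> has real part 0 for every scalar \<open>c\<close>, where
  \<open>z\<close> is the difference of the two sides; \<open>c = rc_cnj z\<close> then gives
  \<open>z = 0\<close>.\<close>

lemma symm_imp_self_adjoint: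
  assumes "symm T" "T \<in> bounded_ops scl"
  shows "self_adjoint ip T"
  unfolding self_adjoint_def is_adjoint_def
proof (intro allI)
  fix x y
  define z where "z = ip (T x) y - ip x (T y)"
  have "c * z + rc_cnj (c * z) = 0" for c
  proof -
    have "ip (T (scl c x)) y + ip y (T (scl c x)) = ip (scl c x) (T y) + ip (T y) (scl c x)"
      using symmD[OF assms(1), of "scl c x" y] by (simp flip: of_real_inner)
    then have "c * ip (T x) y + rc_cnj (c * ip (T x) y) = c * ip x (T y) + rc_cnj (c * ip x (T y))"
      using assms(2) by (simp add: bounded_ops_def ip_commute[of _ y] ip_commute[of _ "T y"] ip_scl_left)
        (metis ip_commute ip_scl_left)
    moreover have "rc_cnj (c * ip (T x) y) = rc_cnj (c * ip x (T y)) + rc_cnj (c * z)"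
      by (simp add: z_def algebra_simps flip: rc_cnj_add)
    ultimately show ?thesis by (simp add: z_def algebra_simps)
  qed
  from this[of "rc_cnj z"] have "of_real ((norm z)\<^sup>2) + rc_cnj (of_real ((norm z)\<^sup>2)) = (0 :: 'k)"
    by (simp add: mult.commute[of "rc_cnj z"] mult_rc_cnj)
  then have "of_real ((norm z)\<^sup>2 + (norm z)\<^sup>2) = (0 :: 'k)"
    by (simp only: rc_cnj_of_real of_real_add)
  then have "z = 0" by (simp only: of_real_eq_0_iff) simp
  then show "ip (T x) y = ip x (T y)" by (simp add: z_def)
qed

lemma projections_eq:
  assumes "A \<subseteq> bounded_ops scl"
  shows "projections ip A = {P \<in> A. is_proj P}"
  using assms self_adjoint_imp_symm symm_imp_self_adjoint
  by (auto simp: projections_def is_proj_def)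

lemma proj_meet_eq:
  assumes "is_glb (projections ip (bounded_ops scl)) P Q M"
  shows "proj_meet scl ip P Q = M"
  unfolding proj_meet_def
proof (rule the_equality)
  fix R
  assume R: "R \<in> projections ip (bounded_ops scl) \<and> proj_le R P \<and> proj_le R Q \<and>
        (\<forall>S \<in> projections ip (bounded_ops scl). proj_le S P \<and> proj_le S Q \<longrightarrow> proj_le S R)"
  with assms have "R o\<^sub>L M = R" "M o\<^sub>L R = M" unfolding is_glb_def proj_le_def by blast+
  moreover have "is_proj R" "is_proj M" using R assms by (simp_all add: is_glb_def projections_eq)
  ultimately show "R = M" using proj_le_antisym by blast
qed (use assms in \<open>auto simp: is_glb_def proj_le_def\<close>)

lemma proj_join_eq:
  assumes "is_lub (projections ip (bounded_ops scl)) P Q J"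
  shows "proj_join scl ip P Q = J"
  unfolding proj_join_def
proof (rule the_equality)
  fix R
  assume R: "R \<in> projections ip (bounded_ops scl) \<and> proj_le P R \<and> proj_le Q R \<and>
        (\<forall>S \<in> projections ip (bounded_ops scl). proj_le P S \<and> proj_le Q S \<longrightarrow> proj_le R S)"
  with assms have "R o\<^sub>L J = R" "J o\<^sub>L R = J" unfolding is_lub_def proj_le_def by blast+
  moreover have "is_proj R" "is_proj J" using R assms by (simp_all add: is_lub_def projections_eq)
  ultimately show "R = J" using proj_le_antisym by blast
qed (use assms in \<open>auto simp: is_lub_def proj_le_def\<close>)

lemma proj_meet_is_glb:
  assumes "P \<in> projections ip (bounded_ops scl)" "Q \<in> projections ip (bounded_ops scl)"
  shows "is_glb (projections ip (bounded_ops scl)) P Q (proj_meet scl ip P Q)"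
proof -
  have P: "is_proj P" "\<And>c x. P (scl c x) = scl c (P x)" and Q: "is_proj Q" "\<And>c x. Q (scl c x) = scl c (Q x)"
    using assms by (auto simp: projections_eq bounded_ops_def)
  obtain R where R: "is_proj R" "R o\<^sub>L P = R" "R o\<^sub>L Q = R"
    "\<And>S :: 'a \<Rightarrow>\<^sub>L 'a. S o\<^sub>L P = S \<Longrightarrow> S o\<^sub>L Q = S \<Longrightarrow> S o\<^sub>L R = S"
    "\<And>(u :: 'a \<Rightarrow> 'a) x. bounded_linear u \<Longrightarrow> (\<And>x. P (u x) = u (P x)) \<Longrightarrow> (\<And>x. Q (u x) = u (Q x)) \<Longrightarrow> R (u x) = u (R x)"
    using meet_exists[OF P(1) Q(1)] by blast
  have "R \<in> bounded_ops scl"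
    using R(5)[OF bounded_linear_scl P(2) Q(2)] by (simp add: bounded_ops_def)
  then have "is_glb (projections ip (bounded_ops scl)) P Q R"
    using R by (auto simp: is_glb_def projections_eq)
  then show ?thesis using proj_meet_eq by simp
qed

text \<open>De Morgan in B(H), where the identity is available.\<close>

lemma proj_join_is_lub:
  assumes "P \<in> projections ip (bounded_ops scl)" "Q \<in> projections ip (bounded_ops scl)"
  shows "is_lub (projections ip (bounded_ops scl)) P Q (proj_join scl ip P Q)"
proof -
  let ?D = "projections ip (bounded_ops scl)"
  have compl: "id_blinfun - S \<in> ?D" if "S \<in> ?D" for S
    using that is_proj_diff[OF is_proj_id, of S]
    by (auto simp: projections_eq blinfun_compose_id bounded_ops_def blinfun.diff_left scale_right_diff_distrib)
  let ?M = "proj_meet scl ip (id_blinfun - P) (id_blinfun - Q)"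
  have M: "is_glb ?D (id_blinfun - P) (id_blinfun - Q) ?M"
    by (intro proj_meet_is_glb compl assms)
  have pr: "is_proj S" if "S \<in> ?D" for S using that by (simp add: projections_eq)
  have MD: "?M \<in> ?D" and MP: "?M o\<^sub>L P = 0" and MQ: "?M o\<^sub>L Q = 0"
    using M by (auto simp: is_glb_def blinfun_compose_distribs blinfun_compose_id)
  have PM: "P o\<^sub>L ?M = 0" "Q o\<^sub>L ?M = 0"
    using symm_swap[OF is_projD(1) is_projD(1) symm_simps(1)] MP MQ pr MD assms by blast+
  have "is_lub ?D P Q (id_blinfun - ?M)"
    unfolding is_lub_def
  proof (intro conjI ballI impI)
    show "id_blinfun - ?M \<in> ?D" by (rule compl[OF MD])
    show "P o\<^sub>L (id_blinfun - ?M) = P" "Q o\<^sub>L (id_blinfun - ?M) = Q"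
      by (simp_all add: blinfun_compose_distribs blinfun_compose_id PM)
    fix S assume S: "S \<in> ?D" "P o\<^sub>L S = P \<and> Q o\<^sub>L S = Q"
    then have SP: "S o\<^sub>L P = P" "S o\<^sub>L Q = Q" using proj_le_swap pr assms by blast+
    have "(id_blinfun - S) o\<^sub>L (id_blinfun - P) = id_blinfun - S"
      "(id_blinfun - S) o\<^sub>L (id_blinfun - Q) = id_blinfun - S"
      by (simp_all add: blinfun_compose_distribs blinfun_compose_id SP)
    then have "(id_blinfun - S) o\<^sub>L ?M = id_blinfun - S"
      using M compl[OF S(1)] unfolding is_glb_def by blast
    then have "?M o\<^sub>L (id_blinfun - S) = id_blinfun - S"
      by (rule proj_le_swap[OF pr[OF compl[OF S(1)]] pr[OF MD]])
    then show "(id_blinfun - ?M) o\<^sub>L S = id_blinfun - ?M"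
      by (simp add: blinfun_compose_distribs blinfun_compose_id algebra_simps)
  qed
  then show ?thesis using proj_join_eq by simp
qed

section \<open>The unitization, and real rank zero of corners\<close>

lemma scaleR_eq_op_scale: "r *\<^sub>R T = op_scale scl (of_real r) T"
  by (intro blinfun_eqI) (simp add: op_scale_apply scl_of_real blinfun.scaleR_left)

lemma op_algebra_of_cstar: "cstar_subalgebra scl ip A \<Longrightarrow> op_algebra A"
  by (auto simp: cstar_subalgebra_def scaleR_eq_op_scale intro!: op_algebra.intro)

text \<open>If \<open>S\<close> is the adjoint of \<open>e\<close>, then \<open>S e = S\<close>. So
  the inner product of \<open>e x\<close> with \<open>y\<close> equals that of \<open>e x\<close>
  with \<open>e y\<close>, which is symmetric in \<open>x\<close> and \<open>y\<close>.\<close>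

lemma unit_is_proj:
  assumes "cstar_subalgebra scl ip A" "is_unit_of A e"
  shows "is_proj e"
proof (rule is_projI)
  have e: "e \<in> A" "\<And>a. a \<in> A \<Longrightarrow> e o\<^sub>L a = a \<and> a o\<^sub>L e = a"
    using assms(2) by (auto simp: is_unit_of_def)
  obtain S where S: "S \<in> A" "is_adjoint ip e S"
    using assms(1) e(1) by (auto simp: cstar_subalgebra_def)
  have adj: "e x \<bullet> y = x \<bullet> S y" for x y
    using S(2) inner_eq_of_ip_eq unfolding is_adjoint_def by blast
  have "S (e y) = S y" for y using e(2)[OF S(1)] by (simp add: comp_apply_eq)
  then have ee: "e x \<bullet> y = e x \<bullet> e y" for x y by (metis adj)
  show "symm e" unfolding symm_def
    using ee by (metis inner_commute)
  show "e (e x) = e x" for x using e by (simp add: comp_apply_eq)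
qed

lemma unitization_unit:
  assumes A: "cstar_subalgebra scl ip A"
  obtains e where "is_unit_of (unitization scl A) e" "is_proj e" "A \<subseteq> unitization scl A"
    "\<And>a. a \<in> A \<Longrightarrow> a + e \<in> unitization scl A" "\<And>a. a \<in> A \<Longrightarrow> a o\<^sub>L e = a"
    "unitization scl A \<subseteq> {T. \<forall>a\<in>A. a o\<^sub>L T \<in> A \<and> T o\<^sub>L a \<in> A}"
    "unitization scl A \<subseteq> bounded_ops scl"
proof (cases "\<exists>e. is_unit_of A e")
  case True
  then obtain e where e: "is_unit_of A e" by blast
  moreover have "A \<subseteq> {T. \<forall>a\<in>A. a o\<^sub>L T \<in> A \<and> T o\<^sub>L a \<in> A}" "A \<subseteq> bounded_ops scl"
    using A by (auto simp: cstar_subalgebra_def)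
  moreover have "e \<in> A" "\<And>a. a \<in> A \<Longrightarrow> a o\<^sub>L e = a" using e by (auto simp: is_unit_of_def)
  moreover have "a + e \<in> A" if "a \<in> A" for a
    using A that \<open>e \<in> A\<close> by (simp add: cstar_subalgebra_def)
  moreover have "unitization scl A = A" using True by (simp add: unitization_def)
  ultimately show thesis using that[of e] unit_is_proj[OF A e] by simp
next
  case False
  let ?U = "{a + op_scale scl c id_blinfun | a c. a \<in> A}"
  have U: "unitization scl A = ?U" using False by (simp add: unitization_def)
  have Ab: "a (scl c x) = scl c (a x)" if "a \<in> A" for a c x
    using A that by (auto simp: cstar_subalgebra_def bounded_ops_def)
  have id: "op_scale scl 1 id_blinfun = id_blinfun" "op_scale scl 0 id_blinfun = 0"
    by (auto intro!: blinfun_eqI simp: op_scale_apply)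
  have memU: "a + op_scale scl c id_blinfun \<in> ?U" if "a \<in> A" for a c using that by blast
  have "0 \<in> A" using A by (simp add: cstar_subalgebra_def)
  then have "id_blinfun \<in> ?U" using memU[of 0 1] by (simp only: id add_0_left)
  then have "is_unit_of ?U id_blinfun" by (auto simp: is_unit_of_def blinfun_compose_id)
  moreover have "A \<subseteq> ?U"
  proof
    show "a \<in> ?U" if "a \<in> A" for a using memU[OF that, of 0] by (simp only: id add_0_right)
  qed
  moreover have "a + id_blinfun \<in> ?U" if "a \<in> A" for a
    using memU[OF that, of 1] by (simp only: id)
  moreover have "?U \<subseteq> {T. \<forall>a\<in>A. a o\<^sub>L T \<in> A \<and> T o\<^sub>L a \<in> A}"
  proof safe
    fix b a c assume ab: "b \<in> A" "a \<in> A"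
    have "a o\<^sub>L (b + op_scale scl c id_blinfun) = (a o\<^sub>L b) + op_scale scl c a"
      "(b + op_scale scl c id_blinfun) o\<^sub>L a = (b o\<^sub>L a) + op_scale scl c a"
      by (auto intro!: blinfun_eqI simp: op_scale_apply blinfun.add_left blinfun.add_right Ab[OF ab(2)])
    then show "a o\<^sub>L (b + op_scale scl c id_blinfun) \<in> A" "(b + op_scale scl c id_blinfun) o\<^sub>L a \<in> A"
      using A ab by (auto simp: cstar_subalgebra_def)
  qed
  moreover have "?U \<subseteq> bounded_ops scl"
    by (auto simp: bounded_ops_def op_scale_apply blinfun.add_left Ab scale_right_distrib mult.commute)
  ultimately show thesis
    using that[of id_blinfun] by (simp add: U is_proj_id blinfun_compose_id)
qed

text \<open>Adding \<open>e - p\<close> fills the complementary block of \<open>x\<close> with its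
  unit. An invertible \<open>b\<close> close to \<open>x + (e - p)\<close> then returns to the
  corner by \<open>corner_perturbation\<close>.\<close>

lemma rr0_corner_approx:
  assumes A: "cstar_subalgebra scl ip A" and rr0: "real_rank_zero scl ip A"
    and p: "is_proj p" "p \<in> A" and x: "x \<in> op_algebra.corner A p" and \<eta>: "\<eta> > 0"
  shows "\<exists>y\<in>op_algebra.corner A p. \<exists>K>0. norm (x - y) \<le> \<eta> \<and> (\<forall>v. norm (p v) \<le> K * norm (y v))"
proof -
  interpret A: op_algebra A by (rule op_algebra_of_cstar[OF A])
  define I where "I = {T. \<forall>a\<in>A. a o\<^sub>L T \<in> A \<and> T o\<^sub>L a \<in> A}"
  interpret I: op_algebra I unfolding I_def by (rule A.idealizer)
  obtain e where e_raw: "is_unit_of (unitization scl A) e" "is_proj e" "A \<subseteq> unitization scl A"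
    "\<And>a. a \<in> A \<Longrightarrow> a + e \<in> unitization scl A" "\<And>a. a \<in> A \<Longrightarrow> a o\<^sub>L e = a"
    "unitization scl A \<subseteq> {T. \<forall>a\<in>A. a o\<^sub>L T \<in> A \<and> T o\<^sub>L a \<in> A}"
    "unitization scl A \<subseteq> bounded_ops scl"
    by (rule unitization_unit[OF A], rule that) blast+
  note e = e_raw[folded I_def]
  have xA: "x \<in> A" "symm x" "p o\<^sub>L x = x" using x by (auto simp: A.corner_def)
  have xI: "x \<in> I.corner p" using xA e(3,6) by (auto simp: I.corner_def)
  \<comment> \<open>The Schur complement doubles the error, and needs \<delta> \<le> 1/2 for the
    complementary block to be invertible.\<close>
  define \<delta> where "\<delta> = min (\<eta> / 2) (1 / 2)"
  have \<delta>: "0 < \<delta>" "\<delta> \<le> 1/2" "2 * \<delta> \<le> \<eta>" using \<eta> by (auto simp: \<delta>_def)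
  let ?z = "x + (e - p)"
  have zU: "?z \<in> unitization scl A"
    using e(4)[OF A.diff_mem[OF xA(1) p(2)]] by (simp add: algebra_simps)
  moreover have "symm ?z" using xA(2) is_projD(1)[OF p(1)] is_projD(1)[OF e(2)] by simp
  ultimately have "?z \<in> {a \<in> unitization scl A. self_adjoint ip a}"
    using e(7) symm_imp_self_adjoint by blast
  then have "?z \<in> closure {a \<in> unitization scl A. self_adjoint ip a \<and> invertible_in (unitization scl A) a}"
    using rr0 unfolding real_rank_zero_def by blast
  then obtain b where b: "b \<in> unitization scl A" "self_adjoint ip b"
    "invertible_in (unitization scl A) b" "dist b ?z < \<delta>"
    using \<delta>(1) unfolding closure_approachable by blast
  obtain e' d where "is_unit_of (unitization scl A) e'" "d o\<^sub>L b = e'"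
    using b(3) unfolding invertible_in_def by blast
  moreover from this have "e' = e" using e(1) unfolding is_unit_of_def by metis
  ultimately have d: "d o\<^sub>L b = e" by simp
  have eb: "e o\<^sub>L b = b" "e \<in> I" using e(1,6) b(1) by (auto simp: is_unit_of_def)
  obtain u where u: "u \<in> I" "p o\<^sub>L u o\<^sub>L p \<in> I.corner p" "norm (x - (p o\<^sub>L u o\<^sub>L p)) \<le> 2 * \<delta>"
    "\<And>v. norm (p v) \<le> norm d * norm ((p o\<^sub>L u o\<^sub>L p) v)"
  proof (rule I.corner_perturbation[OF p(1) _ e(2) eb(2) e(5)[OF p(2)] _ _ eb(1) d xI \<delta>(1,2)])
    show "p \<in> I" "b \<in> I" using p(2) b(1) e(3,6) by auto
    show "symm b" using b(2) by (rule self_adjoint_imp_symm)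
    show "norm (b - ?z) \<le> \<delta>" using b(4) by (simp add: dist_norm)
  qed blast
  let ?y = "p o\<^sub>L u o\<^sub>L p"
  have "?y \<in> A" using u(1) p(2) A.compose_mem by (simp add: I_def)
  then have "?y \<in> A.corner p" using u(2) by (simp add: I.corner_def A.corner_def)
  \<comment> \<open>The summand 1 keeps the constant positive if \<open>d = 0\<close>.\<close>
  moreover have "norm (p v) \<le> (norm d + 1) * norm (?y v)" for v
    using u(4)[of v] norm_ge_zero[of "?y v"] unfolding distrib_right by linarith
  moreover have "norm d + 1 > 0" by (simp add: add_nonneg_pos)
  moreover have "norm (x - ?y) \<le> \<eta>" using u(3) \<delta>(3) by linarith
  ultimately show ?thesis by blast
qed

lemma rr0_sigma_closed_of_cstar:
  assumes A: "cstar_subalgebra scl ip A" and rr0: "real_rank_zero scl ip A"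
    and sigma: "sigma_closed (projections ip A) proj_le 0"
  shows "rr0_sigma_closed A"
proof (intro rr0_sigma_closed.intro op_algebra_of_cstar[OF A] rr0_sigma_closed_axioms.intro)
  have Ab: "A \<subseteq> bounded_ops scl" using A by (simp add: cstar_subalgebra_def)
  show "\<exists>q\<in>A. is_proj q \<and> q \<noteq> 0 \<and> (\<forall>n. q o\<^sub>L P n = q)"
    if "\<And>n. is_proj (P n) \<and> P n \<in> A \<and> P n \<noteq> 0" "\<And>n. P (Suc n) o\<^sub>L P n = P (Suc n)" for P :: "nat \<Rightarrow> 'a \<Rightarrow>\<^sub>L 'a"
    using sigma[unfolded sigma_closed_def, rule_format, of P] that
    by (auto simp: projections_eq[OF Ab] proj_le_def)
qed (use rr0_corner_approx[OF A rr0] in blast)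

end

theorem mainTheorem6:
  fixes scl :: "'k::rc_field \<Rightarrow> 'a::{real_inner,complete_space} \<Rightarrow> 'a"
    and ip :: "'a \<Rightarrow> 'a \<Rightarrow> 'k"
    and A :: "('a \<Rightarrow>\<^sub>L 'a) set"
  assumes "hilbert_space scl ip"
    and "cstar_subalgebra scl ip A"
    and "real_rank_zero scl ip A"
    and "sigma_closed (projections ip A) proj_le 0"
  shows "\<forall>P \<in> projections ip A. \<forall>Q \<in> projections ip A.
           proj_meet scl ip P Q \<in> A \<longleftrightarrow> proj_join scl ip P Q \<in> A"
proof (intro ballI)
  interpret hilbert_space scl ip by fact
  interpret rr0_sigma_closed A using assms(2-4) by (rule rr0_sigma_closed_of_cstar)
  let ?D = "projections ip (bounded_ops scl)"
  have Ab: "A \<subseteq> bounded_ops scl" using assms(2) by (simp add: cstar_subalgebra_def)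
  have D: "\<And>S. S \<in> ?D \<Longrightarrow> is_proj S" "\<And>S. is_proj S \<Longrightarrow> S \<in> A \<Longrightarrow> S \<in> ?D"
    using Ab by (auto simp: projections_eq)
  fix P Q assume "P \<in> projections ip A" "Q \<in> projections ip A"
  then have P: "is_proj P" "P \<in> A" "P \<in> ?D" and Q: "is_proj Q" "Q \<in> A" "Q \<in> ?D"
    using D(2) by (auto simp: projections_eq[OF Ab])
  show "proj_meet scl ip P Q \<in> A \<longleftrightarrow> proj_join scl ip P Q \<in> A"
  proof
    assume "proj_meet scl ip P Q \<in> A"
    then obtain J where "J \<in> A" "is_lub ?D P Q J"
      using join_mem_of_meet_mem[OF D P(1,2) Q(1,2) proj_meet_is_glb[OF P(3) Q(3)]] by blast
    then show "proj_join scl ip P Q \<in> A" using proj_join_eq by simp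
  next
    assume "proj_join scl ip P Q \<in> A"
    then obtain M where "M \<in> A" "is_glb ?D P Q M"
      using meet_mem_of_join_mem[OF D P(1,2) Q(1,2) proj_join_is_lub[OF P(3) Q(3)]] by blast
    then show "proj_meet scl ip P Q \<in> A" using proj_meet_eq by simp
  qed
qed

end
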